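(* Let $D$ be a direct tract of $f$. Then there exists $z_0\in D$ such that $f^n(z_0)\in D$ for all $n\in\mathbb{N}$ and $f^n(z_0)\to\infty$ as $n\to\infty$.
   Context: A direct tract of $f$: $D$ is an unbounded domain in $\mathbb{C}$ whose boundary consists of piecewise smooth curves and whose complement is unbounded; $f$ is a complex-valued function whose domain of definition contains $\overline{D}$ (it need not be defined elsewhere), $f$ is holomorphic in $D$ and continuous on $\overline{D}$, and there exists $R>0$ with $|f(z)|=R$ for $z\in\partial D$ and $|f(z)|>R$ for $z\in D$. *)

theory Defs
  imports "HOL-Complex_Analysis.Complex_Analysis"
begin

definition piecewise_smooth_boundary :: "complex set \<Rightarrow> bool" where
  "piecewise_smooth_boundary D \<longleftrightarrow>
     (\<forall>w\<in>frontier D. \<exists>g. valid_path g \<and> arc g \<and> w \<in> path_image g \<and> path_image g \<subseteq> frontier D)"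

definition direct_tract :: "complex set \<Rightarrow> (complex \<Rightarrow> complex) \<Rightarrow> bool" where
  "direct_tract D f \<longleftrightarrow>
     open D \<and> connected D \<and> D \<noteq> {} \<and> \<not> bounded D \<and> \<not> bounded (- D) \<and>
     piecewise_smooth_boundary D \<and>
     f holomorphic_on D \<and> continuous_on (closure D) f \<and>
     (\<exists>R>0. (\<forall>z\<in>frontier D. norm (f z) = R) \<and> (\<forall>z\<in>D. norm (f z) > R))"

end

theory Submission
  imports Defs
begin

text \<open>Write \<open>h = log(|f|/R)\<close> on \<open>D\<close> and \<open>h = 0\<close> elsewhere, a continuous subharmonic function on the plane.
  Where a circle lies in \<open>D\<close>, the circular mean of \<open>h\<close> has slope an integer, the winding number
  of \<open>f\<close>, as a function of the logarithm of the radius, and this slope is at least 1 if the centre lies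
  outside \<open>D\<close>. This integrality has two consequences.

  First, since the complement of \<open>D\<close> is unbounded, \<open>h\<close> is not \<open>O(log|z|)\<close>.
  Secondly, if \<open>h\<close> is bounded in a disc around \<open>z0\<close> by a harmonic function that exceeds \<open>h\<close> at \<open>z0\<close>
  only slightly, then a smaller concentric disc of comparable radius contains no point outside \<open>D\<close>.
  Such discs are found at maximum points of \<open>h\<close> minus a steep radial barrier.
  On the hole-free disc \<open>log f\<close> is holomorphic with large derivative, so by Bloch's theorem \<open>f\<close> maps the
  disc over an annulus \<open>{exp y \<le> |w| \<le> exp (y + 1)}\<close> much further out, which contains the next disc. A point
  whose orbit follows this sequence of discs is obtained by compactness.\<close>

subsection \<open>Continuous subharmonic functions and circular means\<close>

text \<open>The obstacle is that \<open>D\<close> may have infinitely many holes: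
  \<open>log f\<close> then has no branch on \<open>D\<close>, and \<open>f\<close> has no global
  power series whose central index could locate good points. Integrality turns soft convexity into
  rigid statements. A positive slope is at least 1, so beyond a circle about a hole the mean of
  \<open>h\<close> gains at least the logarithm of the ratio of the radii, while a nearly sharp
  harmonic majorant allows only a bounded gain. Excluding logarithmic growth takes two arguments: if
  all large circles about a point meet the complement, \<open>h\<close> shrinks by a fixed factor
  between comparable scales; otherwise there are arbitrarily large circles in \<open>D\<close>, and
  integrality of the slopes decides. Hole-free discs are wanted for a branch of
  \<open>log f\<close>; Bloch's theorem then needs only the size of one derivative.\<close>

definition cmean :: "(complex \<Rightarrow> real) \<Rightarrow> complex \<Rightarrow> real \<Rightarrow> real" where
  "cmean u z r = integral {0..1} (\<lambda>t. u (circlepath z r t))"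

text \<open>The admissible radius may depend on the point, so the notion is local. A superharmonic
  \<open>v\<close> is expressed by subharmonicity of its negative throughout.\<close>

definition subharmonic_on :: "complex set \<Rightarrow> (complex \<Rightarrow> real) \<Rightarrow> bool" where
  "subharmonic_on S u \<longleftrightarrow> continuous_on S u \<and>
     (\<forall>z\<in>S. \<exists>e>0. cball z e \<subseteq> S \<and> (\<forall>r\<in>{0<..e}. u z \<le> cmean u z r))"

lemma circlepath_in_sphere: "0 \<le> r \<Longrightarrow> circlepath z r t \<in> sphere z r"
  by (simp add: circlepath dist_norm norm_mult)

lemma continuous_on_circlepath: "continuous_on S (circlepath z r)"
  unfolding circlepath by (intro continuous_intros)

lemma continuous_on_compose_circlepath:
  assumes "continuous_on (sphere z r) u" "0 \<le> r"
  shows "continuous_on T (\<lambda>t. u (circlepath z r t))"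
  by (rule continuous_on_compose2[OF assms(1) continuous_on_circlepath])
     (use assms(2) circlepath_in_sphere in auto)

lemma integrable_circlepath:
  fixes u :: "complex \<Rightarrow> real"
  assumes "continuous_on (sphere z r) u" "0 \<le> r"
  shows "(\<lambda>t. u (circlepath z r t)) integrable_on {0..1::real}"
  by (intro integrable_continuous_interval continuous_on_compose_circlepath assms)

lemma cmean_add:
  assumes "continuous_on (sphere z r) u" "continuous_on (sphere z r) v" "0 \<le> r"
  shows "cmean (\<lambda>x. u x + v x) z r = cmean u z r + cmean v z r"
  unfolding cmean_def by (intro integral_add integrable_circlepath assms)

lemma cmean_cmult: "cmean (\<lambda>x. c * u x) z r = c * cmean u z r"
  unfolding cmean_def by simp

lemma cmean_const [simp]: "cmean (\<lambda>x. c) z r = c"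
  unfolding cmean_def by simp

lemma cmean_cong:
  assumes "\<And>x. x \<in> sphere z r \<Longrightarrow> u x = v x" "0 \<le> r"
  shows "cmean u z r = cmean v z r"
  unfolding cmean_def using circlepath_in_sphere[OF assms(2)] assms(1) by simp

lemma cmean_mono:
  assumes "continuous_on (sphere z r) u" "continuous_on (sphere z r) v" "0 \<le> r"
    and "\<And>x. x \<in> sphere z r \<Longrightarrow> u x \<le> v x"
  shows "cmean u z r \<le> cmean v z r"
  unfolding cmean_def
  by (intro integral_le integrable_circlepath assms circlepath_in_sphere)

lemma sphere_eq_circlepath:
  assumes "0 \<le> r" "x \<in> sphere z r"
  obtains t where "t \<in> {0..1}" "x = circlepath z r t"
proof -
  have "x \<in> circlepath z r ` {0..1}"
    using assms path_image_circlepath_nonneg[of r z] by (simp add: path_image_def)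
  then show ?thesis
    using that by blast
qed

lemma cmean_eq_imp_eq:
  assumes "continuous_on (sphere z r) u" "continuous_on (sphere z r) v" "0 \<le> r"
    and "\<And>x. x \<in> sphere z r \<Longrightarrow> u x \<le> v x" "cmean v z r \<le> cmean u z r" "x \<in> sphere z r"
  shows "u x = v x"
proof -
  have c: "continuous_on {0..1} (\<lambda>t. v (circlepath z r t) - u (circlepath z r t))"
    by (intro continuous_intros continuous_on_compose_circlepath assms)
  have n: "v (circlepath z r t) - u (circlepath z r t) \<ge> 0" for t
    using assms(4)[OF circlepath_in_sphere[OF assms(3)]] by simp
  have "integral {0..1} (\<lambda>t. v (circlepath z r t) - u (circlepath z r t)) = cmean v z r - cmean u z r"
    unfolding cmean_def by (intro integral_diff integrable_circlepath assms)
  moreover have "integral {0..1} (\<lambda>t. v (circlepath z r t) - u (circlepath z r t)) \<ge> 0"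
    using n by (intro integral_nonneg integrable_continuous_interval c) auto
  ultimately have "integral {0..1} (\<lambda>t. v (circlepath z r t) - u (circlepath z r t)) = 0"
    using assms(5) by linarith
  then have "\<forall>t\<in>{0..1}. v (circlepath z r t) - u (circlepath z r t) = 0"
    using integral_eq_0_iff[OF c] n by auto
  then show ?thesis
    using sphere_eq_circlepath[OF assms(3,6)] by (metis eq_iff_diff_eq_0)
qed

text \<open>Cauchy's formula: the derivative of \<open>circlepath\<close>, divided by the path minus
  its centre, is the constant 2 pi i, so the contour integral is a plain mean of
  \<open>g\<close>.\<close>

lemma cmean_Re_holomorphic:
  assumes "g holomorphic_on ball z s" "0 < r" "r < s"
  shows "cmean (\<lambda>x. Re (g x)) z r = Re (g z)"
proof -
  have "((\<lambda>u. g u / (u - z)) has_contour_integral (2 * of_real pi * \<i> * g z)) (circlepath z r)"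
  proof (rule Cauchy_integral_circlepath_simple)
    show "g holomorphic_on cball z r"
      using assms by (auto intro: holomorphic_on_subset)
  qed (use assms in auto)
  then have "((\<lambda>t. g (circlepath z r t) / (circlepath z r t - z) * vector_derivative (circlepath z r) (at t))
      has_integral (2 * of_real pi * \<i> * g z)) {0..1}"
    by (simp add: has_contour_integral)
  also have "(\<lambda>t. g (circlepath z r t) / (circlepath z r t - z) * vector_derivative (circlepath z r) (at t))
      = (\<lambda>t. g (circlepath z r t) * (2 * of_real pi * \<i>))"
    using assms by (simp add: vector_derivative_circlepath fun_eq_iff) (simp add: circlepath field_simps)
  finally have "((\<lambda>t. g (circlepath z r t) * (2 * of_real pi * \<i>) * inverse (2 * of_real pi * \<i>))
      has_integral (2 * of_real pi * \<i> * g z) * inverse (2 * of_real pi * \<i>)) {0..1}"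
    by (rule has_integral_mult_left)
  then have "((\<lambda>t. g (circlepath z r t)) has_integral g z) {0..1}"
    by (simp add: field_simps)
  then have "((\<lambda>t. Re (g (circlepath z r t))) has_integral Re (g z)) {0..1}"
    using has_integral_linear[OF _ bounded_linear_Re] by (auto simp: o_def)
  then show ?thesis
    unfolding cmean_def by (rule integral_unique)
qed

lemma subharmonic_on_Re:
  assumes "g holomorphic_on S" "open S"
  shows "subharmonic_on S (\<lambda>x. Re (g x))"
  unfolding subharmonic_on_def
proof (intro conjI ballI)
  show "continuous_on S (\<lambda>x. Re (g x))"
    using assms by (intro continuous_intros holomorphic_on_imp_continuous_on)
next
  fix z assume "z \<in> S"
  then obtain e where e: "e > 0" "cball z e \<subseteq> S"
    using assms(2) open_contains_cball by blast
  have g: "g holomorphic_on ball z e"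
    using e assms(1) by (meson ball_subset_cball holomorphic_on_subset)
  show "\<exists>e>0. cball z e \<subseteq> S \<and> (\<forall>r\<in>{0<..e}. Re (g z) \<le> cmean (\<lambda>x. Re (g x)) z r)"
    using e cmean_Re_holomorphic[OF g] by (intro exI[of _ "e/2"]) auto
qed

lemma subharmonic_on_continuous: "subharmonic_on S u \<Longrightarrow> continuous_on S u"
  by (simp add: subharmonic_on_def)

lemma subharmonic_on_open: "subharmonic_on S u \<Longrightarrow> open S"
  unfolding subharmonic_on_def open_contains_cball by blast

lemma subharmonic_on_add:
  assumes "subharmonic_on S u" "subharmonic_on S v"
  shows "subharmonic_on S (\<lambda>x. u x + v x)"
  unfolding subharmonic_on_def
proof (intro conjI ballI)
  show "continuous_on S (\<lambda>x. u x + v x)"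
    using assms by (intro continuous_intros subharmonic_on_continuous)
next
  fix z assume "z \<in> S"
  then obtain d e where d: "d > 0" "cball z d \<subseteq> S" "\<forall>r\<in>{0<..d}. u z \<le> cmean u z r"
    and e: "e > 0" "cball z e \<subseteq> S" "\<forall>r\<in>{0<..e}. v z \<le> cmean v z r"
    using assms unfolding subharmonic_on_def by metis
  have "u z + v z \<le> cmean (\<lambda>x. u x + v x) z r" if r: "r \<in> {0<..min d e}" for r
  proof -
    have sub: "sphere z r \<subseteq> S"
      using r d by auto
    have "cmean (\<lambda>x. u x + v x) z r = cmean u z r + cmean v z r"
      using r sub assms by (intro cmean_add continuous_on_subset[OF subharmonic_on_continuous]) auto
    then show ?thesis
      using d e r by (smt (verit) greaterThanAtMost_iff min_def)
  qed
  then show "\<exists>e>0. cball z e \<subseteq> S \<and> (\<forall>r\<in>{0<..e}. u z + v z \<le> cmean (\<lambda>x. u x + v x) z r)"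
    using d e by (intro exI[of _ "min d e"]) auto
qed

lemma subharmonic_on_cmult:
  assumes "subharmonic_on S u" "0 \<le> c"
  shows "subharmonic_on S (\<lambda>x. c * u x)"
  unfolding subharmonic_on_def cmean_cmult
proof (intro conjI)
  show "continuous_on S (\<lambda>x. c * u x)"
    using assms by (intro continuous_intros subharmonic_on_continuous)
  show "\<forall>z\<in>S. \<exists>e>0. cball z e \<subseteq> S \<and> (\<forall>r\<in>{0<..e}. c * u z \<le> c * cmean u z r)"
    using assms unfolding subharmonic_on_def by (meson mult_left_mono)
qed

lemma subharmonic_on_const: "open S \<Longrightarrow> subharmonic_on S (\<lambda>x. c)"
  unfolding subharmonic_on_def cmean_const open_contains_cball by auto

lemma subharmonic_on_sum:
  assumes "finite I" "open S" "\<And>i. i \<in> I \<Longrightarrow> subharmonic_on S (u i)"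
  shows "subharmonic_on S (\<lambda>x. \<Sum>i\<in>I. u i x)"
  using assms
  by (induction I rule: finite_induct) (auto intro: subharmonic_on_add subharmonic_on_const)

lemma subharmonic_on_subset:
  assumes "subharmonic_on S u" "open T" "T \<subseteq> S"
  shows "subharmonic_on T u"
  unfolding subharmonic_on_def
proof (intro conjI ballI)
  show "continuous_on T u"
    using assms subharmonic_on_continuous continuous_on_subset by blast
next
  fix z assume z: "z \<in> T"
  then obtain d where d: "d > 0" "cball z d \<subseteq> S" "\<forall>r\<in>{0<..d}. u z \<le> cmean u z r"
    using assms unfolding subharmonic_on_def by (metis subsetD)
  obtain e where e: "e > 0" "cball z e \<subseteq> T"
    using assms(2) z open_contains_cball by blast
  show "\<exists>e>0. cball z e \<subseteq> T \<and> (\<forall>r\<in>{0<..e}. u z \<le> cmean u z r)"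
    using d e by (intro exI[of _ "min d e"]) auto
qed

lemma subharmonic_on_max:
  assumes "subharmonic_on S u" "subharmonic_on S v"
  shows "subharmonic_on S (\<lambda>x. max (u x) (v x))"
  unfolding subharmonic_on_def
proof (intro conjI ballI)
  show "continuous_on S (\<lambda>x. max (u x) (v x))"
    using assms by (intro continuous_intros subharmonic_on_continuous)
next
  fix z assume "z \<in> S"
  then obtain d e where d: "d > 0" "cball z d \<subseteq> S" "\<forall>r\<in>{0<..d}. u z \<le> cmean u z r"
    and e: "e > 0" "cball z e \<subseteq> S" "\<forall>r\<in>{0<..e}. v z \<le> cmean v z r"
    using assms unfolding subharmonic_on_def by metis
  have "max (u z) (v z) \<le> cmean (\<lambda>x. max (u x) (v x)) z r" if r: "r \<in> {0<..min d e}" for r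
  proof -
    have sub: "sphere z r \<subseteq> S"
      using r d by auto
    have c: "continuous_on (sphere z r) u" "continuous_on (sphere z r) v"
      using sub assms by (auto intro: continuous_on_subset[OF subharmonic_on_continuous])
    have "cmean u z r \<le> cmean (\<lambda>x. max (u x) (v x)) z r" "cmean v z r \<le> cmean (\<lambda>x. max (u x) (v x)) z r"
      using r by (auto intro!: cmean_mono c continuous_intros)
    then show ?thesis
      using d e r by (smt (verit) greaterThanAtMost_iff min_def)
  qed
  then show "\<exists>e>0. cball z e \<subseteq> S \<and> (\<forall>r\<in>{0<..e}. max (u z) (v z) \<le> cmean (\<lambda>x. max (u x) (v x)) z r)"
    using d e by (intro exI[of _ "min d e"]) auto
qed

text \<open>A maximum point with maximal real part has a circle around it on which the maximum is
  attained identically, and this circle reaches further to the right.\<close>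

lemma subharmonic_maximum_principle:
  assumes u: "subharmonic_on S u" and "bounded S" and c: "continuous_on (closure S) u"
    and fr: "\<And>z. z \<in> frontier S \<Longrightarrow> u z \<le> 0" and "z \<in> S"
  shows "u z \<le> 0"
proof (rule ccontr)
  assume neg: "\<not> u z \<le> 0"
  have oS: "open S"
    using u by (rule subharmonic_on_open)
  have cpt: "compact (closure S)"
    using \<open>bounded S\<close> by simp
  obtain m where m: "m \<in> closure S" "\<And>x. x \<in> closure S \<Longrightarrow> u x \<le> u m"
    using continuous_attains_sup[OF cpt _ c] \<open>z \<in> S\<close> closure_subset by (metis empty_iff subsetD)
  define K where "K = {x \<in> closure S. u x = u m}"
  have "closed K"
    unfolding K_def by (intro continuous_closed_preimage_constant c) simp
  moreover have "K \<subseteq> closure S"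
    by (auto simp: K_def)
  ultimately have cK: "compact K"
    using cpt by (meson bounded_subset compact_eq_bounded_closed)
  have "K \<noteq> {}"
    using m by (auto simp: K_def)
  then obtain k where k: "k \<in> K" "\<And>x. x \<in> K \<Longrightarrow> Re x \<le> Re k"
    using continuous_attains_sup[OF cK _ continuous_on_Re[OF continuous_on_id]] by auto
  have "u z \<le> u m"
    using m \<open>z \<in> S\<close> closure_subset by blast
  then have "k \<notin> frontier S"
    using fr k neg unfolding K_def by fastforce
  then have "k \<in> S"
    using k oS unfolding K_def frontier_def by (simp add: interior_open)
  then obtain e where e: "e > 0" "cball k e \<subseteq> S" "\<forall>r\<in>{0<..e}. u k \<le> cmean u k r"
    using u unfolding subharmonic_on_def by metis
  have se: "sphere k e \<subseteq> S"
    using e by auto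
  have "u (k + of_real e) = u m"
  proof (rule cmean_eq_imp_eq[of k e u "\<lambda>x. u m"])
    show "continuous_on (sphere k e) u"
      using se u continuous_on_subset subharmonic_on_continuous by blast
    show "\<And>x. x \<in> sphere k e \<Longrightarrow> u x \<le> u m"
      using m se closure_subset by blast
    show "cmean (\<lambda>x. u m) k e \<le> cmean u k e"
      using e k by (simp add: K_def)
  qed (use e in \<open>auto simp: dist_norm\<close>)
  moreover have "k + of_real e \<in> S"
    using e by (intro subsetD[OF e(2)]) (auto simp: dist_norm)
  ultimately have "k + of_real e \<in> K"
    using closure_subset by (auto simp: K_def)
  then show False
    using k(2)[of "k + of_real e"] e by simp
qed

lemma subharmonic_le_superharmonic:
  assumes u: "subharmonic_on S u" and v: "subharmonic_on S (\<lambda>x. - v x)" and "bounded S"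
    and cu: "continuous_on (closure S) u" and cv: "continuous_on (closure S) v"
    and fr: "\<And>z. z \<in> frontier S \<Longrightarrow> u z \<le> v z" and "z \<in> S"
  shows "u z \<le> v z"
proof -
  have "subharmonic_on S (\<lambda>x. u x + - v x)"
    by (rule subharmonic_on_add[OF u v])
  then have "u z + - v z \<le> 0"
  proof (rule subharmonic_maximum_principle)
    show "continuous_on (closure S) (\<lambda>x. u x + - v x)"
      by (intro continuous_intros cu cv)
  qed (use assms in auto)
  then show ?thesis by simp
qed

subsection \<open>Radial means and maxima are convex in the logarithm of the radius\<close>

lemma integral_period_shift:
  fixes F :: "real \<Rightarrow> real"
  assumes F: "continuous_on UNIV F" and per: "\<And>t. F (t + 1) = F t" and "0 \<le> a"
  shows "integral {a..a + 1} F = integral {0..1} F"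
proof -
  have int: "F integrable_on {x..y}" for x y
    using F continuous_on_subset integrable_continuous_interval by blast
  have "integral {0..a} F + integral {a..a + 1} F = integral {0..a + 1} F"
    "integral {0..1} F + integral {1..a + 1} F = integral {0..a + 1} F"
    using \<open>0 \<le> a\<close> int by (intro Henstock_Kurzweil_Integration.integral_combine; simp)+
  moreover have "integral {1..a + 1} F = integral {0..a} F"
    using integral_shift_real_ivl[of 1 1 "a + 1" F] by (simp add: per)
  ultimately show ?thesis
    by simp
qed

text \<open>The free starting point \<open>a\<close> matters: when it is the parameter of a point on
  a circle, the nodes are the images of that point under rotations by k/n of a turn.\<close>

lemma riemann_sum_bound:
  fixes F :: "real \<Rightarrow> real"
  assumes F: "continuous_on UNIV F" and "n > 0"
    and osc: "\<And>x y. \<bar>x - y\<bar> \<le> 1 / real n \<Longrightarrow> \<bar>F x - F y\<bar> \<le> e"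
  shows "\<bar>integral {a..a + 1} F - (\<Sum>k::nat<n. F (a + k / n)) / n\<bar> \<le> e"
proof -
  have int: "F integrable_on {x..y}" for x y
    using F continuous_on_subset integrable_continuous_interval by blast
  have "\<bar>integral {a..a + m / n} F - (\<Sum>k::nat<m. F (a + k / n)) / n\<bar> \<le> m * e / n" for m :: nat
  proof (induction m)
    case (Suc m)
    let ?l = "a + m / n" and ?r = "a + Suc m / n"
    have lr: "a \<le> ?l" "?l \<le> ?r" "?r - ?l = 1 / n"
      by (auto simp: add_divide_distrib)
    have "integral {a..?l} F + integral {?l..?r} F = integral {a..?r} F"
      by (intro Henstock_Kurzweil_Integration.integral_combine lr int)
    moreover have "\<bar>integral {?l..?r} F - F ?l / n\<bar> \<le> e / n"
    proof -
      have "norm (integral {?l..?r} (\<lambda>x. F x - F ?l)) \<le> e * (?r - ?l)"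
      proof (rule integral_bound)
        show "continuous_on {?l..?r} (\<lambda>x. F x - F ?l)"
          using F by (intro continuous_intros) (auto intro: continuous_on_subset)
        show "norm (F x - F ?l) \<le> e" if "x \<in> {?l..?r}" for x
          using osc[of x ?l] that lr by auto
      qed (rule lr)
      moreover have "integral {?l..?r} (\<lambda>x. F x - F ?l) = integral {?l..?r} F - F ?l / n"
        using lr int by (subst integral_diff) auto
      ultimately show ?thesis
        using lr(3) by simp
    qed
    ultimately show ?case
      using Suc by (simp add: add_divide_distrib algebra_simps)
  qed auto
  from this[of n] show ?thesis
    using \<open>n > 0\<close> by simp
qed

lemma circlepath_rotate:
  "circlepath w r (a + t) = w + exp (2 * of_real pi * \<i> * of_real t) * (circlepath w r a - w)"
  by (simp add: circlepath exp_add algebra_simps)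

lemma circlepath_rotate_center:
  assumes "norm \<zeta> = 1"
  obtains a where "0 \<le> a" "\<And>z r t. w + \<zeta> * (circlepath z r t - w) = circlepath (w + \<zeta> * (z - w)) r (t + a)"
proof -
  have "\<zeta> \<in> sphere 0 1"
    using assms by simp
  then obtain a where a: "a \<in> {0..1}" "\<zeta> = circlepath 0 1 a"
    using sphere_eq_circlepath[of 1 \<zeta> 0] by auto
  show ?thesis
    by (rule that[of a]) (use a in \<open>auto simp: circlepath algebra_simps exp_add\<close>)
qed

lemma cmean_rotate:
  assumes u: "continuous_on (sphere z r) u" "0 \<le> r" and "0 \<le> a"
  shows "integral {0..1} (\<lambda>t. u (circlepath z r (t + a))) = cmean u z r"
proof -
  have c: "continuous_on UNIV (\<lambda>t. u (circlepath z r t))"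
    by (intro continuous_on_compose_circlepath u)
  have "integral {0..1} (\<lambda>t. u (circlepath z r (t + a))) = integral {a..a + 1} (\<lambda>t. u (circlepath z r t))"
    using integral_shift_real_ivl[of a a "a + 1" "\<lambda>t. u (circlepath z r t)"] by simp
  also have "\<dots> = cmean u z r"
    unfolding cmean_def using c \<open>0 \<le> a\<close> by (intro integral_period_shift) (auto simp: circlepath_add1)
  finally show ?thesis .
qed

section \<open>Rotations and averages over finitely many of them\<close>

lemma subharmonic_on_rotate:
  assumes u: "subharmonic_on UNIV u" and "norm \<zeta> = 1"
  shows "subharmonic_on UNIV (\<lambda>z. u (w + \<zeta> * (z - w)))"
  unfolding subharmonic_on_def
proof (intro conjI ballI)
  have cu: "continuous_on UNIV u"
    using u by (rule subharmonic_on_continuous)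
  then show "continuous_on UNIV (\<lambda>z. u (w + \<zeta> * (z - w)))"
    by (rule continuous_on_compose2) (auto intro!: continuous_intros)
  fix z
  obtain a where a: "0 \<le> a" "\<And>z r t. w + \<zeta> * (circlepath z r t - w) = circlepath (w + \<zeta> * (z - w)) r (t + a)"
    using circlepath_rotate_center[OF assms(2)] by blast
  have "cmean (\<lambda>z. u (w + \<zeta> * (z - w))) z r = cmean u (w + \<zeta> * (z - w)) r" if "r > 0" for r
  proof -
    have "cmean (\<lambda>z. u (w + \<zeta> * (z - w))) z r = integral {0..1} (\<lambda>t. u (circlepath (w + \<zeta> * (z - w)) r (t + a)))"
      unfolding cmean_def a(2) ..
    also have "\<dots> = cmean u (w + \<zeta> * (z - w)) r"
      using that a(1) cu by (intro cmean_rotate) (auto intro: continuous_on_subset)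
    finally show ?thesis .
  qed
  moreover obtain e where "e > 0" "\<forall>r\<in>{0<..e}. u (w + \<zeta> * (z - w)) \<le> cmean u (w + \<zeta> * (z - w)) r"
    using u unfolding subharmonic_on_def by blast
  ultimately show "\<exists>e>0. cball z e \<subseteq> UNIV \<and> (\<forall>r\<in>{0<..e}. u (w + \<zeta> * (z - w)) \<le> cmean (\<lambda>z. u (w + \<zeta> * (z - w))) z r)"
    by (intro exI[of _ e]) auto
qed

definition rotavg :: "(complex \<Rightarrow> real) \<Rightarrow> complex \<Rightarrow> nat \<Rightarrow> complex \<Rightarrow> real" where
  "rotavg u w n z = (1 / n) * (\<Sum>k::nat<n. u (w + exp (2 * of_real pi * \<i> * of_real (k / n)) * (z - w)))"

lemma subharmonic_on_rotavg:
  assumes "subharmonic_on UNIV u"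
  shows "subharmonic_on UNIV (rotavg u w n)"
proof -
  have [simp]: "norm (exp (2 * complex_of_real pi * \<i> * complex_of_real x)) = 1" for x
    by simp
  show ?thesis
    unfolding rotavg_def using assms
    by (intro subharmonic_on_cmult subharmonic_on_sum subharmonic_on_rotate) auto
qed

lemma dist_circlepath_le:
  assumes "0 \<le> r"
  shows "dist (circlepath w r s) (circlepath w r t) \<le> 2 * pi * r * \<bar>s - t\<bar>"
proof -
  have "circlepath w r s = w + exp (2 * of_real pi * \<i> * of_real (s - t)) * (circlepath w r t - w)"
    using circlepath_rotate[of w r t "s - t"] by simp
  then have "circlepath w r s - circlepath w r t
      = (exp (\<i> * of_real (2 * pi * (s - t))) - 1) * (circlepath w r t - w)"
    by (simp add: algebra_simps)
  then have "dist (circlepath w r s) (circlepath w r t)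
      = 2 * \<bar>sin (pi * (s - t))\<bar> * r"
    using circlepath_in_sphere[OF assms, of w t] unfolding dist_norm
    by (simp only: norm_mult dist_exp_i_1) (simp add: dist_norm norm_minus_commute)
  also have "\<dots> \<le> 2 * \<bar>pi * (s - t)\<bar> * r"
    using assms by (intro mult_right_mono mult_left_mono abs_sin_x_le_abs_x) auto
  also have "\<dots> = 2 * pi * r * \<bar>s - t\<bar>"
    by (simp add: abs_mult)
  finally show ?thesis .
qed

text \<open>Uniform continuity gives one \<open>n\<close> for all radii up to \<open>T\<close>,
  because a rotation by 1/n of a turn moves a point at distance at most \<open>T\<close> from
  \<open>w\<close> by at most 2 pi T / n.\<close>

lemma rotavg_close:
  assumes u: "continuous_on UNIV u" and "e > 0"
  obtains n where "n > 0" "\<And>z. dist w z \<le> T \<Longrightarrow> \<bar>cmean u w (dist w z) - rotavg u w n z\<bar> \<le> e"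
proof -
  define T' where "T' = max T 1"
  have "uniformly_continuous_on (cball w T') u"
    using u by (intro compact_uniformly_continuous) (auto intro: continuous_on_subset)
  then obtain d where d: "d > 0" "\<And>x y. x \<in> cball w T' \<Longrightarrow> y \<in> cball w T' \<Longrightarrow> dist x y < d \<Longrightarrow> dist (u x) (u y) < e"
    unfolding uniformly_continuous_on_def using \<open>e > 0\<close> by metis
  obtain n :: nat where n: "n > 0" "2 * pi * T' / n < d"
  proof -
    obtain n :: nat where "real n > 2 * pi * T' / d"
      using reals_Archimedean2 by blast
    moreover have "2 * pi * T' / d > 0"
      using d by (auto simp: T'_def)
    ultimately have "n > 0" "2 * pi * T' / d < real n"
      by (auto intro: gr0I)
    then show ?thesis
      using d by (intro that[of n]) (auto simp: field_simps)
  qed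
  show ?thesis
  proof (rule that[OF n(1)])
    fix z assume z: "dist w z \<le> T"
    obtain a where a: "a \<in> {0..1}" "z = circlepath w (dist w z) a"
      using sphere_eq_circlepath[of "dist w z" z w] by auto
    define F where "F t = u (circlepath w (dist w z) t)" for t
    have c: "continuous_on UNIV F"
      unfolding F_def using u by (intro continuous_on_compose_circlepath) (auto intro: continuous_on_subset)
    have osc: "\<bar>F x - F y\<bar> \<le> e" if "\<bar>x - y\<bar> \<le> 1 / n" for x y
    proof -
      have "dist (circlepath w (dist w z) x) (circlepath w (dist w z) y) \<le> 2 * pi * dist w z * \<bar>x - y\<bar>"
        by (rule dist_circlepath_le) simp
      also have "\<dots> \<le> 2 * pi * T' * (1 / n)"
        using that z by (intro mult_mono) (auto simp: T'_def)
      also have "\<dots> < d"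
        using n by simp
      finally have "dist (F x) (F y) < e"
        unfolding F_def using z circlepath_in_sphere[of "dist w z" w]
        by (intro d(2)) (auto simp: T'_def)
      then show ?thesis
        by (simp add: dist_real_def)
    qed
    have "\<bar>integral {a..a + 1} F - (\<Sum>k::nat<n. F (a + k / n)) / n\<bar> \<le> e"
      by (rule riemann_sum_bound[OF c n(1) osc])
    moreover have "integral {a..a + 1} F = cmean u w (dist w z)"
      using integral_period_shift[OF c, of a] a(1) by (simp add: F_def[abs_def] circlepath_add1 cmean_def)
    moreover have "F (a + k / n) = u (w + exp (2 * of_real pi * \<i> * of_real (k / n)) * (z - w))" for k
      unfolding F_def circlepath_rotate using a(2) by simp
    ultimately show "\<bar>cmean u w (dist w z) - rotavg u w n z\<bar> \<le> e"
      by (simp add: rotavg_def)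
  qed
qed

text \<open>The radial mean is a uniform limit of averages over finitely many rotations. For such a
  finite average the local sub-mean inequality is inherited with a common radius.\<close>

lemma cmean_le_superharmonic:
  assumes u: "subharmonic_on UNIV u" and "bounded S" and q: "subharmonic_on S (\<lambda>x. - q x)"
    and cq: "continuous_on (closure S) q"
    and fr: "\<And>z. z \<in> frontier S \<Longrightarrow> cmean u w (dist w z) \<le> q z" and "z \<in> S"
  shows "cmean u w (dist w z) \<le> q z"
proof (rule field_le_epsilon)
  fix e :: real assume "e > 0"
  obtain T where T: "closure S \<subseteq> cball w T"
    using \<open>bounded S\<close> by (meson bounded_closure bounded_any_center bounded_def mem_cball subsetI)
  have cu: "continuous_on UNIV u"
    using u by (rule subharmonic_on_continuous)
  obtain n where n: "n > 0" "\<And>z. dist w z \<le> T \<Longrightarrow> \<bar>cmean u w (dist w z) - rotavg u w n z\<bar> \<le> e / 2"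
    using rotavg_close[OF cu, of "e / 2"] \<open>e > 0\<close> by auto
  have "rotavg u w n z \<le> q z + e / 2"
  proof (rule subharmonic_le_superharmonic[OF _ _ \<open>bounded S\<close> _ _ _ \<open>z \<in> S\<close>])
    have oS: "open S"
      using q by (rule subharmonic_on_open)
    show "subharmonic_on S (rotavg u w n)"
      using subharmonic_on_rotavg[OF u] oS subharmonic_on_subset by blast
    show "continuous_on (closure S) (rotavg u w n)"
      using subharmonic_on_continuous[OF subharmonic_on_rotavg[OF u]] continuous_on_subset by blast
    show "subharmonic_on S (\<lambda>x. - (q x + e / 2))"
      using subharmonic_on_add[OF q subharmonic_on_const[OF oS, of "- e / 2"]] by (simp add: algebra_simps)
    show "continuous_on (closure S) (\<lambda>x. q x + e / 2)"
      by (intro continuous_intros cq)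
    show "rotavg u w n x \<le> q x + e / 2" if "x \<in> frontier S" for x
    proof -
      have "dist w x \<le> T"
        using that T by (auto simp: frontier_def)
      then show ?thesis
        using fr[OF that] n(2)[of x] by linarith
    qed
  qed
  moreover have "dist w z \<le> T"
    using T \<open>z \<in> S\<close> closure_subset by force
  ultimately show "cmean u w (dist w z) \<le> q z + e"
    using n(2)[of z] by linarith
qed

section \<open>Locality, and harmonicity of the logarithm of a modulus\<close>

lemma subharmonic_on_local:
  assumes "\<And>z. z \<in> S \<Longrightarrow> \<exists>T. z \<in> T \<and> T \<subseteq> S \<and> subharmonic_on T u"
  shows "subharmonic_on S u"
  unfolding subharmonic_on_def
proof (intro conjI ballI)
  have "isCont u z" if "z \<in> S" for z
    using assms[OF that] subharmonic_on_open subharmonic_on_continuous continuous_on_eq_continuous_at by blast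
  then show "continuous_on S u"
    by (simp add: continuous_at_imp_continuous_on)
  show "\<exists>e>0. cball z e \<subseteq> S \<and> (\<forall>r\<in>{0<..e}. u z \<le> cmean u z r)" if "z \<in> S" for z
    using assms[OF that] unfolding subharmonic_on_def by (metis subset_trans)
qed

lemma subharmonic_on_cong:
  assumes "\<And>z. z \<in> S \<Longrightarrow> u z = v z"
  shows "subharmonic_on S u \<longleftrightarrow> subharmonic_on S v"
proof -
  have "cmean u z r = cmean v z r" if "cball z e \<subseteq> S" "r \<in> {0<..e}" for z e r
    using that assms by (intro cmean_cong) (auto simp: subset_iff)
  then show ?thesis
    unfolding subharmonic_on_def using assms continuous_on_cong[of S S u v] by (metis (mono_tags, lifting))
qed

text \<open>On a disc a zero-free \<open>f\<close> has a holomorphic logarithm, whose real part is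
  ln|f|. Both signs are recorded because such functions serve as minorants and as majorants.\<close>

lemma subharmonic_on_ln_norm:
  assumes "f holomorphic_on S" "open S" "\<And>z. z \<in> S \<Longrightarrow> f z \<noteq> 0"
  shows "subharmonic_on S (\<lambda>z. ln (norm (f z)))" "subharmonic_on S (\<lambda>z. - ln (norm (f z)))"
proof -
  have *: "\<exists>T. z \<in> T \<and> T \<subseteq> S \<and> subharmonic_on T (\<lambda>z. ln (norm (f z))) \<and> subharmonic_on T (\<lambda>z. - ln (norm (f z)))"
    if z: "z \<in> S" for z
  proof -
    obtain e where e: "e > 0" "ball z e \<subseteq> S"
      using z assms(2) open_contains_ball by blast
    have "f holomorphic_on ball z e"
      using e assms(1) holomorphic_on_subset by blast
    then obtain g where g: "g holomorphic_on ball z e" "\<And>x. x \<in> ball z e \<Longrightarrow> f x = exp (g x)"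
      using contractible_imp_holomorphic_log[of f "ball z e"] convex_imp_contractible[OF convex_ball] e assms(3)
      by (metis subsetD)
    have "subharmonic_on (ball z e) (\<lambda>x. Re (g x))" "subharmonic_on (ball z e) (\<lambda>x. Re (- g x))"
      by (intro subharmonic_on_Re holomorphic_intros g open_ball)+
    moreover have "ln (norm (f x)) = Re (g x)" if "x \<in> ball z e" for x
      using g(2)[OF that] by simp
    ultimately have "subharmonic_on (ball z e) (\<lambda>z. ln (norm (f z)))" "subharmonic_on (ball z e) (\<lambda>z. - ln (norm (f z)))"
      using subharmonic_on_cong[of "ball z e" "\<lambda>z. ln (norm (f z))" "\<lambda>x. Re (g x)"]
        subharmonic_on_cong[of "ball z e" "\<lambda>z. - ln (norm (f z))" "\<lambda>x. Re (- g x)"] by auto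
    then show ?thesis
      using e by (intro exI[of _ "ball z e"]) auto
  qed
  show "subharmonic_on S (\<lambda>z. ln (norm (f z)))" "subharmonic_on S (\<lambda>z. - ln (norm (f z)))"
    by (rule subharmonic_on_local, drule *, blast)+
qed

section \<open>Maxima over circles, and what they share with means\<close>

definition maxmod :: "(complex \<Rightarrow> real) \<Rightarrow> complex \<Rightarrow> real \<Rightarrow> real" where
  "maxmod u w r = Sup (u ` sphere w r)"

lemma maxmod_attained:
  assumes "continuous_on UNIV u" "0 \<le> r"
  obtains z where "dist w z = r" "u z = maxmod u w r"
proof -
  have ne: "u ` sphere w r \<noteq> {}"
    using \<open>0 \<le> r\<close> by simp
  have "compact (u ` sphere w r)"
    using assms by (intro compact_continuous_image) (auto intro: continuous_on_subset)
  then have "maxmod u w r \<in> u ` sphere w r"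
    unfolding maxmod_def
    using ne by (intro closed_contains_Sup bounded_imp_bdd_above compact_imp_bounded compact_imp_closed)
  then show ?thesis
    using that by auto
qed

lemma le_maxmod:
  assumes "continuous_on UNIV u"
  shows "u z \<le> maxmod u w (dist w z)"
proof -
  have "compact (u ` sphere w (dist w z))"
    using assms by (intro compact_continuous_image) (auto intro: continuous_on_subset)
  then show ?thesis
    unfolding maxmod_def
    by (intro cSup_upper bounded_imp_bdd_above compact_imp_bounded) auto
qed

text \<open>For a maximum one rotation suffices: turn a point where the maximum over the circle
  through \<open>z\<close> is attained onto \<open>z\<close>. The rotated function is still at most
  \<open>maxmod\<close> on the frontier.\<close>

lemma maxmod_le_superharmonic:
  assumes u: "subharmonic_on UNIV u" and "bounded S" and q: "subharmonic_on S (\<lambda>x. - q x)"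
    and cq: "continuous_on (closure S) q"
    and fr: "\<And>z. z \<in> frontier S \<Longrightarrow> maxmod u w (dist w z) \<le> q z" and "z \<in> S"
  shows "maxmod u w (dist w z) \<le> q z"
proof -
  have cu: "continuous_on UNIV u"
    using u by (rule subharmonic_on_continuous)
  obtain y where y: "dist w y = dist w z" "u y = maxmod u w (dist w z)"
    using maxmod_attained[OF cu] by (metis zero_le_dist)
  define \<zeta> where "\<zeta> = (if z = w then 1 else (y - w) / (z - w))"
  have \<zeta>: "norm \<zeta> = 1" "w + \<zeta> * (z - w) = y"
    using y(1) by (auto simp: \<zeta>_def dist_norm norm_divide norm_minus_commute)
  have r: "subharmonic_on UNIV (\<lambda>x. u (w + \<zeta> * (x - w)))"
    by (rule subharmonic_on_rotate[OF u \<zeta>(1)])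
  have "u (w + \<zeta> * (z - w)) \<le> q z"
  proof (rule subharmonic_le_superharmonic[OF _ q \<open>bounded S\<close> _ cq _ \<open>z \<in> S\<close>])
    show "subharmonic_on S (\<lambda>x. u (w + \<zeta> * (x - w)))"
      using subharmonic_on_subset[OF r] subharmonic_on_open[OF q] by blast
    show "continuous_on (closure S) (\<lambda>x. u (w + \<zeta> * (x - w)))"
      using subharmonic_on_continuous[OF r] continuous_on_subset by blast
    show "u (w + \<zeta> * (x - w)) \<le> q x" if "x \<in> frontier S" for x
    proof -
      have "dist w (w + \<zeta> * (x - w)) = dist w x"
        using \<zeta>(1) by (simp add: dist_norm norm_mult norm_minus_commute)
      then show ?thesis
        using le_maxmod[OF cu, of "w + \<zeta> * (x - w)" w] fr[OF that] by simp
    qed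
  qed
  then show ?thesis
    by (simp add: \<zeta>(2) y(2))
qed

text \<open>The premise isolates the comparison principle common to \<open>cmean\<close> and
  \<open>maxmod\<close>. Here it is applied on a disc with the constant majorant
  \<open>M t\<close>.\<close>

lemma radial_mono:
  assumes M: "\<And>S q z. bounded S \<Longrightarrow> subharmonic_on S (\<lambda>x. - q x) \<Longrightarrow> continuous_on (closure S) q \<Longrightarrow>
      (\<And>z. z \<in> frontier S \<Longrightarrow> M (dist w z) \<le> q z) \<Longrightarrow> z \<in> S \<Longrightarrow> M (dist w z) \<le> q z"
    and "0 \<le> s" "s \<le> t"
  shows "M s \<le> M t"
proof (cases "s = t")
  case False
  then have st: "s < t" "0 < t"
    using assms by auto
  have "M (dist w (w + of_real s)) \<le> M t"
  proof (rule M[of "ball w t" "\<lambda>_. M t"])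
    show "subharmonic_on (ball w t) (\<lambda>x. - M t)"
      by (intro subharmonic_on_const open_ball)
  qed (use st \<open>0 \<le> s\<close> in \<open>auto simp: dist_norm\<close>)
  then show ?thesis
    using \<open>0 \<le> s\<close> by (simp add: dist_norm)
qed auto

text \<open>Hadamard's three circles argument: on the annulus between two radii \<open>M\<close> is
  compared with a + b ln|z - w|, which is harmonic there and agrees with \<open>M\<close> on both
  boundary circles.\<close>

lemma convex_on_radial_exp:
  assumes M: "\<And>S q z. bounded S \<Longrightarrow> subharmonic_on S (\<lambda>x. - q x) \<Longrightarrow> continuous_on (closure S) q \<Longrightarrow>
      (\<And>z. z \<in> frontier S \<Longrightarrow> M (dist w z) \<le> q z) \<Longrightarrow> z \<in> S \<Longrightarrow> M (dist w z) \<le> q z"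
  shows "convex_on UNIV (\<lambda>x. M (exp x))"
proof (rule convex_on_linorderI)
  fix t x y :: real assume t: "t > 0" "t < 1" and "x < y"
  define H where "H x = M (exp x)" for x
  define b where "b = (H y - H x) / (y - x)"
  define a where "a = H x - b * x"
  have y: "H y = a + b * y" and x: "H x = a + b * x"
  proof -
    have "b * (y - x) = H y - H x"
      using \<open>x < y\<close> by (simp add: b_def)
    then show "H y = a + b * y" "H x = a + b * x"
      by (auto simp: a_def algebra_simps)
  qed
  let ?p = "(1 - t) * x + t * y"
  let ?S = "ball w (exp y) - cball w (exp x)"
  have p: "x < ?p" "?p < y"
  proof -
    have "t * x < t * y" "(1 - t) * x < (1 - t) * y"
      using t \<open>x < y\<close> by auto
    then show "x < ?p" "?p < y"
      by (auto simp: algebra_simps)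
  qed
  have oS: "open ?S"
    by auto
  have cl: "closure ?S \<subseteq> cball w (exp y) - ball w (exp x)"
    by (rule closure_minimal) auto
  have "M (dist w (w + of_real (exp ?p))) \<le> a + b * ln (norm (w + of_real (exp ?p) - w))"
  proof (rule M[of ?S "\<lambda>z. a + b * ln (norm (z - w))"])
    show "bounded ?S"
      by (meson Diff_subset bounded_ball bounded_subset)
    have "subharmonic_on ?S (\<lambda>x. b * ln (norm (x - w)))" "subharmonic_on ?S (\<lambda>x. - (b * ln (norm (x - w))))"
    proof -
      have nz: "z - w \<noteq> 0" if "z \<in> ?S" for z
        using that by auto
      have "subharmonic_on ?S (\<lambda>x. ln (norm (x - w)))" "subharmonic_on ?S (\<lambda>x. - ln (norm (x - w)))"
        using nz oS by (intro subharmonic_on_ln_norm[of "\<lambda>x. x - w"] holomorphic_intros; blast)+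
      note * = this
      show "subharmonic_on ?S (\<lambda>x. - (b * ln (norm (x - w))))"
        using subharmonic_on_cmult[OF *(1), of "- b"] subharmonic_on_cmult[OF *(2), of b] by (cases "b \<ge> 0") auto
      show "subharmonic_on ?S (\<lambda>x. b * ln (norm (x - w)))"
        using subharmonic_on_cmult[OF *(1), of "b"] subharmonic_on_cmult[OF *(2), of "- b"] by (cases "b \<ge> 0") auto
    qed
    from subharmonic_on_add[OF this(2) subharmonic_on_const[OF oS, of "- a"]]
    show "subharmonic_on ?S (\<lambda>x. - (a + b * ln (norm (x - w))))"
      by (simp add: algebra_simps)
    show "continuous_on (closure ?S) (\<lambda>x. a + b * ln (norm (x - w)))"
    proof -
      have "x - w \<noteq> 0" if "x \<in> closure ?S" for x
        using that cl by (auto simp: subset_iff)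
      then show ?thesis
        by (intro continuous_intros) auto
    qed
    show "M (dist w z) \<le> a + b * ln (norm (z - w))" if z: "z \<in> frontier ?S" for z
    proof -
      have "z \<in> cball w (exp y) - ball w (exp x)" "z \<notin> ?S"
        using z cl oS by (auto simp: frontier_def interior_open)
      then have "dist w z = exp x \<or> dist w z = exp y"
        by auto
      then show ?thesis
        using x y unfolding H_def by (auto simp: dist_norm norm_minus_commute)
    qed
    show "w + of_real (exp ?p) \<in> ?S"
      using p by (auto simp: dist_norm simp del: of_real_exp)
  qed
  then have "H ?p \<le> a + b * ?p"
    by (simp add: H_def dist_norm del: of_real_exp)
  also have "\<dots> = (1 - t) * H x + t * H y"
    unfolding x y by (simp add: algebra_simps)
  finally show "M (exp ((1 - t) *\<^sub>R x + t *\<^sub>R y)) \<le> (1 - t) * M (exp x) + t * M (exp y)"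
    by (simp add: H_def)
qed auto

lemma convex_on_cmean_exp:
  assumes "subharmonic_on UNIV u"
  shows "convex_on UNIV (\<lambda>x. cmean u w (exp x))"
  by (rule convex_on_radial_exp[where w = w]) (rule cmean_le_superharmonic[OF assms])

lemma maxmod_mono_radius:
  assumes "subharmonic_on UNIV u" "0 \<le> s" "s \<le> t"
  shows "maxmod u w s \<le> maxmod u w t"
  by (rule radial_mono[where w = w, OF _ assms(2,3)]) (rule maxmod_le_superharmonic[OF assms(1)])

lemma convex_on_maxmod_exp:
  assumes "subharmonic_on UNIV u"
  shows "convex_on UNIV (\<lambda>x. maxmod u w (exp x))"
  by (rule convex_on_radial_exp[where w = w]) (rule maxmod_le_superharmonic[OF assms])

subsection \<open>A lower bound for superharmonic functions that are large on many circles\<close>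

text \<open>In product form this is n^n / n! <= e^n; the induction step is n ln(1 + 1/n) <=
  1.\<close>

lemma sum_ln_ratio_le: "(\<Sum>k=1..n. ln (real n) - ln (real k)) \<le> real n"
proof (induction n)
  case (Suc n)
  show ?case
  proof (cases "n = 0")
    case False
    have "ln (real (Suc n)) - ln (real n) = ln (1 + 1 / n)"
    proof -
      have "1 + 1 / real n = real (Suc n) / real n"
        using False by (simp add: field_simps)
      then show ?thesis
        using False by (simp add: ln_div del: of_nat_Suc)
    qed
    also have "\<dots> \<le> 1 / n"
      by (rule ln_add_one_self_le_self) simp
    finally have *: "n * (ln (real (Suc n)) - ln (real n)) \<le> 1"
      using False by (simp add: field_simps)
    have "(\<Sum>k=1..Suc n. ln (real (Suc n)) - ln (real k))
        = (\<Sum>k=1..n. (ln (real n) - ln (real k)) + (ln (real (Suc n)) - ln (real n)))"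
      by simp
    also have "\<dots> = (\<Sum>k=1..n. ln (real n) - ln (real k)) + n * (ln (real (Suc n)) - ln (real n))"
      by (subst sum.distrib) simp
    finally show ?thesis
      using Suc * by simp
  qed simp
qed simp

lemma sum_ln_le:
  assumes "m \<le> n" "n > 0"
  shows "(\<Sum>k=1..m. ln (8 * real n / real k)) \<le> 4 * real n"
proof -
  have "ln (8::real) \<le> 3"
  proof -
    have "ln (8::real) = 3 * ln 2"
      using ln_realpow[of 2 3] by simp
    then show ?thesis
      using ln_2_less_1 by simp
  qed
  note l8 = this
  have "(\<Sum>k=1..m. ln (8 * real n / real k)) \<le> (\<Sum>k=1..n. ln (8 * real n / real k))"
    using assms by (intro sum_mono2) (auto simp: field_simps)
  also have "\<dots> = (\<Sum>k=1..n. ln 8 + (ln (real n) - ln (real k)))"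
    using assms by (intro sum.cong) (auto simp: ln_div ln_mult)
  also have "\<dots> = n * ln 8 + (\<Sum>k=1..n. ln (real n) - ln (real k))"
    by (subst sum.distrib) simp
  also have "\<dots> \<le> real n * 3 + real n"
    using l8 by (intro add_mono sum_ln_ratio_le mult_left_mono) auto
  finally show ?thesis
    by simp
qed

text \<open>\<open>d j\<close> will be the distance of a point to the j-th of \<open>n\<close>
  points on circles with radii spaced by s/n, and \<open>y\<close> the position of its own radius in
  this numbering. The indices on either side of \<open>y\<close> cost 4n by
  \<open>sum_ln_le\<close>; the two nearest ones, for which only the bound by
  \<open>\<kappa>\<close> is used, cost n each.\<close>

lemma sum_ln_inverse_spaced_le:
  fixes d :: "nat \<Rightarrow> real" and s y :: real
  assumes "n > 0" "s > 0" "\<kappa> > 0" "ln (8 * s / \<kappa>) \<le> n"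
    and d: "\<And>j. j < n \<Longrightarrow> d j \<ge> \<kappa>" "\<And>j. j < n \<Longrightarrow> d j \<ge> s / n * \<bar>y - j\<bar>"
  shows "(\<Sum>j<n. ln (8 * s / d j)) \<le> 10 * real n"
proof -
  define x where "x = max 0 (min y n)"
  define m where "m = nat \<lfloor>x\<rfloor>"
  have x: "0 \<le> x" "x \<le> n" "\<And>j. j < n \<Longrightarrow> \<bar>x - real j\<bar> \<le> \<bar>y - real j\<bar>"
    by (auto simp: x_def)
  have m: "m \<le> x" "x < m + 1"
    using x by (auto simp: m_def intro: of_nat_floor) linarith
  have "m \<le> n"
    using x m by linarith
  have d0: "d j > 0" if "j < n" for j
    using d(1)[OF that] \<open>\<kappa> > 0\<close> by linarith
  have far: "ln (8 * s / d j) \<le> ln (8 * real n / k)" if "j < n" "real k \<le> \<bar>x - j\<bar>" "k > 0" for j k :: nat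
  proof -
    have "s / n * k \<le> s / n * \<bar>y - j\<bar>"
      using that x(3)[OF that(1)] \<open>s > 0\<close> by (intro mult_left_mono) auto
    then have "s / n * k \<le> d j"
      using d(2)[OF that(1)] by linarith
    then have "8 * s / d j \<le> 8 * s / (s / n * k)"
      using that \<open>s > 0\<close> \<open>n > 0\<close> d0 by (intro divide_left_mono) auto
    also have "\<dots> = 8 * real n / k"
      using \<open>s > 0\<close> by simp
    finally show ?thesis
      using d0[OF that(1)] \<open>s > 0\<close> that by (subst ln_le_cancel_iff) auto
  qed
  have near: "ln (8 * s / d j) \<le> n" if "j < n" for j
  proof -
    have "ln (8 * s / d j) \<le> ln (8 * s / \<kappa>)"
      using d0[OF that] d(1)[OF that] \<open>s > 0\<close> \<open>\<kappa> > 0\<close>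
      by (subst ln_le_cancel_iff) (auto intro!: divide_left_mono)
    then show ?thesis
      using assms by linarith
  qed
  let ?g = "\<lambda>j. ln (8 * s / d j)"
  have "(\<Sum>j<m. ?g j) \<le> (\<Sum>j<m. ln (8 * real n / (m - j)))"
  proof (rule sum_mono)
    fix j assume "j \<in> {..<m}"
    then show "?g j \<le> ln (8 * real n / (m - j))"
      using far[of j "m - j"] m \<open>m \<le> n\<close> by (auto simp: of_nat_diff)
  qed
  also have "\<dots> = (\<Sum>k=1..m. ln (8 * real n / k))"
    by (rule sum.reindex_bij_witness[of _ "\<lambda>k. m - k" "\<lambda>j. m - j"]) auto
  also have "\<dots> \<le> 4 * real n"
    using \<open>m \<le> n\<close> \<open>n > 0\<close> by (rule sum_ln_le)
  finally have A: "(\<Sum>j<m. ?g j) \<le> 4 * real n" .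
  \<comment> \<open>Since x < m + 1, an index j >= m + 2 has distance at least j - (m + 1) >= 1 from
    \<open>x\<close>. The indices m and m + 1 are treated separately below.\<close>
  have "(\<Sum>j\<in>{m+2..<n}. ?g j) \<le> (\<Sum>j\<in>{m+2..<n}. ln (8 * real n / (j - (m + 1))))"
  proof (rule sum_mono)
    fix j assume "j \<in> {m+2..<n}"
    then show "?g j \<le> ln (8 * real n / (j - (m + 1)))"
      using far[of j "j - (m + 1)"] m by (auto simp: of_nat_diff)
  qed
  also have "\<dots> = (\<Sum>k=1..n-(m+2). ln (8 * real n / k))"
    by (rule sum.reindex_bij_witness[of _ "\<lambda>k. k + (m + 1)" "\<lambda>j. j - (m + 1)"]) auto
  also have "\<dots> \<le> 4 * real n"
    using \<open>n > 0\<close> by (intro sum_ln_le) auto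
  finally have B: "(\<Sum>j\<in>{m+2..<n}. ?g j) \<le> 4 * real n" .
  have "(\<Sum>j\<in>{m, m+1} \<inter> {..<n}. ?g j) \<le> (\<Sum>j\<in>{m, m+1} \<inter> {..<n}. real n)"
    using near by (intro sum_mono) auto
  also have "\<dots> = card ({m, m+1} \<inter> {..<n}) * real n"
    by simp
  also have "\<dots> \<le> 2 * real n"
    using card_mono[of "{m, m+1}" "{m, m+1} \<inter> {..<n}"] by (intro mult_right_mono) auto
  finally have C: "(\<Sum>j\<in>{m, m+1} \<inter> {..<n}. ?g j) \<le> 2 * real n" .
  have "{..<n} = {..<m} \<union> (({m, m+1} \<inter> {..<n}) \<union> {m+2..<n})"
    using \<open>m \<le> n\<close> by auto
  then have "(\<Sum>j<n. ?g j) = (\<Sum>j\<in>{..<m} \<union> (({m, m+1} \<inter> {..<n}) \<union> {m+2..<n}). ?g j)"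
    by simp
  also have "\<dots> = (\<Sum>j<m. ?g j) + ((\<Sum>j\<in>{m, m+1} \<inter> {..<n}. ?g j) + (\<Sum>j\<in>{m+2..<n}. ?g j))"
    by (subst sum.union_disjoint, simp, simp, force, subst sum.union_disjoint) auto
  finally show ?thesis
    using A B C by linarith
qed

text \<open>The logarithmic potential of finitely many points, one on each of a dense set of circles, is
  bounded by an absolute constant away from the immediate neighbourhood of these points, and serves
  as a minorant of the superharmonic function \<^term>\<open>v\<close>.\<close>

lemma superharmonic_lower_bound:
  fixes v :: "complex \<Rightarrow> real"
  assumes s: "s > 0" and cv: "continuous_on (cball w (10 * s)) v"
    and v: "subharmonic_on (ball w (10 * s)) (\<lambda>x. - v x)"
    and nonneg: "\<And>x. x \<in> cball w (10 * s) \<Longrightarrow> v x \<ge> 0" and m: "m > 0"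
    and meet: "\<And>t. t \<in> {s..2 * s} \<Longrightarrow> \<exists>x. dist w x = t \<and> v x \<ge> m"
    and z: "dist w z \<le> 2 * s"
  shows "v z \<ge> m / 40"
proof (cases "v z \<ge> m / 2")
  case True
  then show ?thesis using m by linarith
next
  case False
  \<comment> \<open>Off \<open>S\<close> the function \<open>v\<close> is large anyway. On the
    closure of \<open>S\<close> it is at most m/2, so uniform continuity keeps a distance
    \<open>\<kappa>\<close> from all points where \<open>v\<close> is at least \<open>m\<close>, the
    future poles of \<open>p\<close>.\<close>
  define S where "S = {x \<in> ball w (10 * s). v x < m / 2}"
  have "z \<in> S"
    using False z s by (auto simp: S_def)
  have "uniformly_continuous_on (cball w (10 * s)) v"
    by (intro compact_uniformly_continuous cv) auto
  then obtain \<kappa> where \<kappa>: "\<kappa> > 0"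
    "\<And>x y. x \<in> cball w (10 * s) \<Longrightarrow> y \<in> cball w (10 * s) \<Longrightarrow> dist x y < \<kappa> \<Longrightarrow> dist (v x) (v y) < m / 2"
    unfolding uniformly_continuous_on_def using m by (metis half_gt_zero)
  \<comment> \<open>With this many circles a pole at distance \<open>\<kappa>\<close> contributes at
    most 1 to the average \<open>p\<close>.\<close>
  obtain n0 :: nat where n0: "ln (8 * s / \<kappa>) \<le> n0"
    using real_arch_simple by blast
  define n where "n = Suc n0"
  have n: "n > 0" "ln (8 * s / \<kappa>) \<le> n"
    using n0 by (auto simp: n_def)
  have "\<exists>x. dist w x = s * (1 + j / n) \<and> v x \<ge> m" if "j < n" for j
    using that s by (intro meet) (auto simp: field_simps)
  then obtain \<zeta> where \<zeta>: "\<And>j. j < n \<Longrightarrow> dist w (\<zeta> j) = s * (1 + j / n)" "\<And>j. j < n \<Longrightarrow> v (\<zeta> j) \<ge> m"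
    by metis
  have \<zeta>2: "dist w (\<zeta> j) \<le> 2 * s" if "j < n" for j
  proof -
    have "s * (1 + j / n) \<le> s * 2"
      using that s by (intro mult_left_mono) auto
    then show ?thesis
      using \<zeta>(1)[OF that] by simp
  qed
  \<comment> \<open>The poles lie within 2 s of \<open>w\<close>, so the numerator 8 s makes each
    term nonpositive at distance 10 s from \<open>w\<close> and at least ln 2 at \<open>z\<close>.
    As p <= 10 on the closure of \<open>S\<close>, the factor m/20 keeps the minorant below m/2;
    with p >= 1/2 at \<open>z\<close> this gives m/40.\<close>
  define p where "p x = (1 / n) * (\<Sum>j<n. ln (norm (of_real (8 * s) / (x - \<zeta> j))))" for x
  have norm_eq: "norm (complex_of_real (8 * s) / (x - \<zeta> j)) = 8 * s / dist x (\<zeta> j)" for x j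
    using s by (simp add: norm_divide dist_norm norm_mult)
  have oS: "open S"
  proof -
    have "continuous_on (ball w (10 * s)) v"
      using cv by (rule continuous_on_subset) auto
    then have "open (ball w (10 * s) \<inter> v -` {..<m / 2})"
      by (intro continuous_open_preimage) auto
    then show ?thesis
      by (simp add: S_def vimage_def Int_def)
  qed
  have clS: "closure S \<subseteq> {x \<in> cball w (10 * s). v x \<le> m / 2}"
  proof (rule closure_minimal)
    have "closed (cball w (10 * s) \<inter> v -` {..m / 2})"
      by (intro continuous_closed_preimage cv) auto
    then show "closed {x \<in> cball w (10 * s). v x \<le> m / 2}"
      by (simp add: vimage_def Int_def)
  qed (auto simp: S_def)
  have apart: "dist x (\<zeta> j) \<ge> \<kappa>" if "x \<in> closure S" "j < n" for x j
  proof (rule ccontr)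
    assume "\<not> dist x (\<zeta> j) \<ge> \<kappa>"
    then have "dist (v x) (v (\<zeta> j)) < m / 2"
      using that clS \<zeta>2[OF that(2)] s by (intro \<kappa>(2)) auto
    then have "\<bar>v x - v (\<zeta> j)\<bar> < m / 2"
      by (simp add: dist_real_def)
    moreover have "v x \<le> m / 2" "v (\<zeta> j) \<ge> m"
      using that clS \<zeta>(2) by auto
    ultimately show False
      by linarith
  qed
  have ne: "x \<noteq> \<zeta> j" if "x \<in> closure S" "j < n" for x j
    using apart[OF that] \<kappa>(1) by auto
  have bound: "p x \<le> 10" if x: "x \<in> closure S" for x
  proof -
    have "(\<Sum>j<n. ln (8 * s / dist x (\<zeta> j))) \<le> 10 * real n"
    proof (rule sum_ln_inverse_spaced_le[OF n(1) s \<kappa>(1) n(2), where y = "n * (dist w x / s - 1)"])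
      show "dist x (\<zeta> j) \<ge> \<kappa>" if "j < n" for j
        using apart[OF x that] .
      show "dist x (\<zeta> j) \<ge> s / n * \<bar>n * (dist w x / s - 1) - j\<bar>" if "j < n" for j
      proof -
        have "s / n * \<bar>n * (dist w x / s - 1) - j\<bar> = \<bar>s / n * (n * (dist w x / s - 1) - j)\<bar>"
          using s by (simp add: abs_mult)
        also have "s / n * (n * (dist w x / s - 1) - j) = dist w x - dist w (\<zeta> j)"
          using s n(1) \<zeta>(1)[OF that] by (simp add: field_simps)
        also have "\<bar>\<dots>\<bar> \<le> dist x (\<zeta> j)"
          by metric
        finally show ?thesis .
      qed
    qed
    then show ?thesis
      using n(1) unfolding p_def norm_eq by (simp add: field_simps)
  qed
  have "m / 20 * p z \<le> v z"
  proof (rule subharmonic_le_superharmonic[of S "\<lambda>x. m / 20 * p x" v z])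
    have hol: "(\<lambda>x. of_real (8 * s) / (x - \<zeta> j)) holomorphic_on S" if "j < n" for j
      using ne[OF _ that] closure_subset by (intro holomorphic_intros) auto
    have nz: "of_real (8 * s) / (x - \<zeta> j) \<noteq> 0" if "x \<in> S" "j < n" for x j
      using ne[OF _ that(2)] closure_subset that s by auto
    show "subharmonic_on S (\<lambda>x. m / 20 * p x)"
      unfolding p_def using hol nz m
      by (intro subharmonic_on_cmult subharmonic_on_sum oS subharmonic_on_ln_norm) auto
    show "subharmonic_on S (\<lambda>x. - v x)"
      using v oS by (rule subharmonic_on_subset) (auto simp: S_def)
    show "bounded S"
      by (rule bounded_subset[of "ball w (10 * s)"]) (auto simp: S_def)
    have "norm (complex_of_real (8 * s) / (x - \<zeta> j)) \<noteq> 0" if "x \<in> closure S" "j < n" for x j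
      using ne[OF that] s by simp
    then show "continuous_on (closure S) (\<lambda>x. m / 20 * p x)"
      unfolding p_def using ne by (intro continuous_intros) auto
    show "continuous_on (closure S) v"
      using clS by (intro continuous_on_subset[OF cv]) auto
    show "m / 20 * p x \<le> v x" if "x \<in> frontier S" for x
    proof -
      have x: "x \<in> closure S" "x \<notin> S" "x \<in> cball w (10 * s)"
        using that oS clS by (auto simp: frontier_def interior_open)
      show ?thesis
      proof (cases "x \<in> ball w (10 * s)")
        case True
        then have "v x \<ge> m / 2"
          using x by (auto simp: S_def)
        moreover have "m / 20 * p x \<le> m / 20 * 10"
          using bound[OF x(1)] m by (intro mult_left_mono) auto
        ultimately show ?thesis
          by simp
      next
        case False
        then have dx: "dist w x = 10 * s"
          using x by auto
        have "ln (norm (of_real (8 * s) / (x - \<zeta> j))) \<le> 0" if "j < n" for j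
        proof -
          have "dist w x \<le> dist w (\<zeta> j) + dist x (\<zeta> j)"
            by metric
          then have "dist x (\<zeta> j) \<ge> 8 * s"
            using dx \<zeta>2[OF that] by simp
          moreover from this have "dist x (\<zeta> j) > 0"
            using s by linarith
          ultimately have "0 < 8 * s / dist x (\<zeta> j)" "8 * s / dist x (\<zeta> j) \<le> 1"
            using s by (simp_all add: field_simps)
          then show ?thesis
            unfolding norm_eq by simp
        qed
        then have "p x \<le> 0"
          unfolding p_def by (intro mult_nonneg_nonpos sum_nonpos) auto
        then have "m / 20 * p x \<le> 0"
          using m by (simp add: mult_nonneg_nonpos)
        then show ?thesis
          using nonneg[OF x(3)] by linarith
      qed
    qed
  qed (use \<open>z \<in> S\<close> in auto)
  moreover have "p z \<ge> 1 / 2"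
  proof -
    have "(\<Sum>j<n. ln (norm (of_real (8 * s) / (z - \<zeta> j)))) \<ge> (\<Sum>j<n. 1 / 2)"
    proof (rule sum_mono)
      fix j assume "j \<in> {..<n}"
      then have j: "j < n" by simp
      have "z \<in> closure S"
        using \<open>z \<in> S\<close> closure_subset by auto
      then have "dist z (\<zeta> j) > 0"
        using ne[OF _ j] by auto
      moreover have "dist z (\<zeta> j) \<le> 4 * s"
        using z \<zeta>2[OF j] by metric
      ultimately have "2 \<le> 8 * s / dist z (\<zeta> j)"
        by (simp add: field_simps)
      then have "ln 2 \<le> ln (8 * s / dist z (\<zeta> j))"
        by (subst ln_le_cancel_iff) auto
      moreover have "1 / 2 \<le> ln (2::real)"
        using ln_le_minus_one[of "1/2::real"] by (simp add: ln_div)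
      ultimately show "1 / 2 \<le> ln (norm (of_real (8 * s) / (z - \<zeta> j)))"
        unfolding norm_eq by linarith
    qed
    then show ?thesis
      using n(1) by (simp add: p_def field_simps)
  qed
  moreover have "m / 20 * p z \<ge> m / 20 * (1 / 2)"
    using \<open>p z \<ge> 1 / 2\<close> m by (intro mult_left_mono) auto
  ultimately show ?thesis
    by simp
qed

subsection \<open>Circles in a tract\<close>

lemma convex_on_supporting_line:
  fixes g :: "real \<Rightarrow> real"
  assumes g: "convex_on UNIV g" and "e > 0" and lin: "\<And>y. \<bar>y - x\<bar> < e \<Longrightarrow> g y = a * y + b"
  shows "a * y + b \<le> g y"
proof -
  define \<theta> where "\<theta> = min 1 (e / (2 * (\<bar>y - x\<bar> + 1)))"
  have \<theta>: "0 < \<theta>" "\<theta> \<le> 1" "\<theta> * \<bar>y - x\<bar> < e"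
  proof -
    show "0 < \<theta>" "\<theta> \<le> 1"
      using \<open>e > 0\<close> by (auto simp: \<theta>_def intro!: divide_pos_pos add_nonneg_pos)
    have "\<theta> * \<bar>y - x\<bar> \<le> e / (2 * (\<bar>y - x\<bar> + 1)) * (\<bar>y - x\<bar> + 1)"
      using \<open>e > 0\<close> by (intro mult_mono) (auto simp: \<theta>_def)
    also have "\<dots> = e / 2"
      by (simp add: field_simps add_nonneg_eq_0_iff)
    finally show "\<theta> * \<bar>y - x\<bar> < e"
      using \<open>e > 0\<close> by linarith
  qed
  let ?p = "(1 - \<theta>) * x + \<theta> * y"
  have "?p - x = \<theta> * (y - x)"
    by (simp add: algebra_simps)
  then have "\<bar>?p - x\<bar> < e"
    using \<theta> by (simp add: abs_mult)
  then have "a * ?p + b = g ?p"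
    using lin by simp
  also have "\<dots> \<le> (1 - \<theta>) * g x + \<theta> * g y"
    using convex_onD[OF g, of \<theta> x y] \<theta> by simp
  also have "g x = a * x + b"
    using lin[of x] \<open>e > 0\<close> by simp
  finally have "\<theta> * (a * y + b) \<le> \<theta> * g y"
    by (simp add: algebra_simps)
  then show ?thesis
    using \<theta> by simp
qed

text \<open>\<open>h\<close> is the function that is \<open>log(|f|/R)\<close> in the tract and vanishes outside; \<open>c = log R\<close>.\<close>

locale log_tract =
  fixes D :: "complex set" and f :: "complex \<Rightarrow> complex" and h :: "complex \<Rightarrow> real" and c :: real
  assumes open_D: "open D" and holomorphic: "f holomorphic_on D"
    and continuous_h: "continuous_on UNIV h"
    and nonzero: "\<And>z. z \<in> D \<Longrightarrow> f z \<noteq> 0"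
    and h_eq: "\<And>z. z \<in> D \<Longrightarrow> h z = ln (norm (f z)) - c"
    and h_pos: "\<And>z. z \<in> D \<Longrightarrow> h z > 0"
    and h_outside: "\<And>z. z \<notin> D \<Longrightarrow> h z = 0"
begin

lemma h_nonneg: "h z \<ge> 0"
  using h_pos[of z] h_outside[of z] by (cases "z \<in> D") auto

lemma h_pos_iff: "h z > 0 \<longleftrightarrow> z \<in> D"
  using h_pos[of z] h_outside[of z] by (cases "z \<in> D") auto

lemma continuous_on_h: "continuous_on S h"
  using continuous_h continuous_on_subset by blast

text \<open>Outside \<open>D\<close> the nonnegative \<open>h\<close> vanishes, so the sub-mean
  inequality is trivial there for every radius.\<close>

lemma subharmonic_h: "subharmonic_on UNIV h"
  unfolding subharmonic_on_def
proof (intro conjI ballI continuous_h)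
  fix z
  show "\<exists>e>0. cball z e \<subseteq> UNIV \<and> (\<forall>r\<in>{0<..e}. h z \<le> cmean h z r)"
  proof (cases "z \<in> D")
    case True
    have "subharmonic_on D (\<lambda>z. ln (norm (f z)) + - c)"
      by (intro subharmonic_on_add subharmonic_on_ln_norm subharmonic_on_const holomorphic open_D nonzero)
    then have "subharmonic_on D h"
      using h_eq by (subst subharmonic_on_cong[where v = "\<lambda>z. ln (norm (f z)) + - c"]) auto
    then show ?thesis
      using True unfolding subharmonic_on_def by blast
  next
    case False
    have "h z \<le> cmean h z r" if "r > 0" for r
      using cmean_mono[of z r "\<lambda>x. 0" h] that False h_nonneg h_outside continuous_on_h by auto
    then show ?thesis
      by (intro exI[of _ 1]) auto
  qed
qed

lemma cmean_h_pos:
  assumes "sphere w t \<subseteq> D" "t > 0"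
  shows "cmean h w t > 0"
proof (rule ccontr)
  assume "\<not> cmean h w t > 0"
  then have "0 = h (w + of_real t)"
    using assms h_nonneg continuous_on_h
    by (intro cmean_eq_imp_eq[of w t "\<lambda>x. 0" h]) (auto simp: dist_norm)
  moreover have "w + of_real t \<in> D"
    using assms by (intro subsetD[OF assms(1)]) (auto simp: dist_norm)
  ultimately show False
    using h_pos by fastforce
qed

text \<open>The slope \<open>N\<close> is the winding number of the image of the circle under \<^term>\<open>f\<close>.\<close>

lemma circle_slope:
  assumes sub: "sphere w t \<subseteq> D" and "t > 0"
  obtains N :: int and k e :: real where "e > 0" "\<And>x. \<bar>x - ln t\<bar> < e \<Longrightarrow> cmean h w (exp x) = real_of_int N * x + k"
proof -
  obtain d where d: "d > 0" "(\<Union>x\<in>sphere w t. ball x d) \<subseteq> D"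
    using compact_subset_open_imp_ball_epsilon_subset[OF _ open_D sub] by auto
  have annulus: "z \<in> D" if "\<bar>dist w z - t\<bar> < d" "z \<noteq> w" for z
  proof -
    define y where "y = w + of_real (t / dist w z) * (z - w)"
    have "dist w y = t"
      using that \<open>t > 0\<close> by (simp add: y_def dist_norm norm_mult norm_minus_commute norm_divide)
    moreover have "y - z = of_real (t / dist w z - 1) * (z - w)"
      by (simp add: y_def algebra_simps)
    then have "dist y z = \<bar>t / dist w z - 1\<bar> * dist w z"
      by (simp add: dist_norm norm_mult norm_minus_commute del: of_real_diff of_real_divide)
    then have "dist y z = \<bar>(t / dist w z - 1) * dist w z\<bar>"
      by (simp add: abs_mult)
    then have "dist y z < d"
      using that by (simp add: left_diff_distrib)
    ultimately have "y \<in> sphere w t" "z \<in> ball y d"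
      by simp_all
    then show ?thesis
      using d(2) by blast
  qed
  have "isCont exp (ln t)"
    by simp
  then obtain e where e: "e > 0" "\<And>x. \<bar>x - ln t\<bar> < e \<Longrightarrow> \<bar>exp x - t\<bar> < d"
    using \<open>d > 0\<close> \<open>t > 0\<close> unfolding continuous_at_eps_delta by (metis dist_real_def exp_ln real_norm_def)
  \<comment> \<open>In the coordinate log(z - w) a thin annulus about the circle becomes this convex
    strip, on which \<open>f\<close> has a logarithm \<open>G\<close>; one turn about
    \<open>w\<close> is translation by 2 pi i.\<close>
  define S where "S = {z. ln t - e < Re z} \<inter> {z. Re z < ln t + e}"
  have S: "open S" "convex S"
    unfolding S_def
    by (intro open_Int open_halfspace_Re_gt open_halfspace_Re_lt
          convex_Int convex_halfspace_Re_gt convex_halfspace_Re_lt)+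
  have inD: "w + exp z \<in> D" if "z \<in> S" for z
    using that e(2)[of "Re z"] by (intro annulus) (auto simp: dist_norm S_def)
  have "(\<lambda>z. f (w + exp z)) holomorphic_on S"
    using inD by (intro holomorphic_on_compose_gen[of "\<lambda>z. w + exp z" S f D, unfolded o_def] holomorphic
        holomorphic_intros) auto
  then obtain G where G: "G holomorphic_on S" "\<And>z. z \<in> S \<Longrightarrow> f (w + exp z) = exp (G z)"
    using contractible_imp_holomorphic_log[of "\<lambda>z. f (w + exp z)" S] convex_imp_contractible[OF S(2)]
      inD nonzero by (metis (no_types, lifting))
  let ?p = "2 * of_real pi * \<i> :: complex"
  have shift: "z + ?p \<in> S" if "z \<in> S" for z
    using that by (simp add: S_def)
  have period: "\<exists>n::int. G (z + ?p) - G z = ?p * of_int n" if "z \<in> S" for z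
  proof -
    have "exp (G (z + ?p)) = exp (G z)"
      using G(2)[OF that] G(2)[OF shift[OF that]] by (simp add: exp_add)
    then obtain n :: int where "G (z + ?p) = G z + (of_int (2 * n) * pi) * \<i>"
      unfolding exp_eq by blast
    then show ?thesis
      by (intro exI[of _ n]) (simp add: algebra_simps)
  qed
  have cG: "continuous_on S G"
    using G(1) by (rule holomorphic_on_imp_continuous_on)
  \<comment> \<open>The increment of \<open>G\<close> over one turn is continuous with values in 2
    pi i times the integers.\<close>
  have "(\<lambda>z. G (z + ?p) - G z) constant_on S"
  proof (rule continuous_discrete_range_constant)
    show "connected S"
      using S convex_connected by blast
    show "continuous_on S (\<lambda>z. G (z + ?p) - G z)"
      using shift by (intro continuous_intros cG continuous_on_compose2[OF cG]) auto
    fix z assume z: "z \<in> S"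
    have "2 * pi \<le> norm (G (y + ?p) - G y - (G (z + ?p) - G z))"
      if y: "y \<in> S" "G (y + ?p) - G y \<noteq> G (z + ?p) - G z" for y
    proof -
      obtain m n :: int where mn: "G (y + ?p) - G y = ?p * of_int m" "G (z + ?p) - G z = ?p * of_int n"
        using period z y by blast
      then have "m \<noteq> n"
        using y by auto
      have "norm (G (y + ?p) - G y - (G (z + ?p) - G z)) = norm (?p * of_int (m - n))"
        unfolding mn by (simp add: algebra_simps)
      also have "\<dots> = 2 * pi * \<bar>real_of_int (m - n)\<bar>"
        by (simp add: norm_mult del: of_int_diff)
      also have "\<dots> \<ge> 2 * pi * 1"
        using \<open>m \<noteq> n\<close> by (intro mult_left_mono) (auto simp: linorder_not_less)
      finally show ?thesis by simp
    qed
    then show "\<exists>e>0. \<forall>y. y \<in> S \<and> G (y + ?p) - G y \<noteq> G (z + ?p) - G z \<longrightarrow>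
        e \<le> norm (G (y + ?p) - G y - (G (z + ?p) - G z))"
      using pi_gt_zero by (intro exI[of _ "2 * pi"]) auto
  qed
  then obtain N0 where N0: "\<And>z. z \<in> S \<Longrightarrow> G (z + ?p) - G z = N0"
    by (auto simp: constant_on_def)
  have lnt: "of_real (ln t) \<in> S"
    using e by (simp add: S_def)
  obtain N :: int where N: "N0 = ?p * of_int N"
    using period[OF lnt] N0[OF lnt] by auto
  obtain \<Phi> where \<Phi>: "\<And>z. z \<in> S \<Longrightarrow> (\<Phi> has_field_derivative G z) (at z within S)"
    using holomorphic_convex_primitive'[OF S(2,1) G(1)] by blast
  \<comment> \<open>\<open>J z\<close> is the mean of \<open>G\<close> over the segment from z to z
    + 2 pi i. Its derivative is the increment of \<open>G\<close> over one turn divided by 2 pi i,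
    the integer \<open>N\<close>, so \<open>J\<close> is affine.\<close>
  define J where "J z = (\<Phi> (z + ?p) - \<Phi> z) / ?p" for z
  have "((\<lambda>z. J z - of_int N * z) has_field_derivative 0) (at z within S)" if z: "z \<in> S" for z
  proof -
    have "(\<Phi> has_field_derivative G z) (at z)" "(\<Phi> has_field_derivative G (z + ?p)) (at (z + ?p))"
      using \<Phi>[OF z] \<Phi>[OF shift[OF z]]
      unfolding at_within_open[OF z S(1)] at_within_open[OF shift[OF z] S(1)] .
    then have "((\<lambda>z. J z - of_int N * z) has_field_derivative ((G (z + ?p) - G z) / ?p - of_int N)) (at z)"
      unfolding J_def
      by (auto intro!: derivative_eq_intros DERIV_chain2[of \<Phi>] simp: field_simps)
    moreover have "(G (z + ?p) - G z) / ?p - of_int N = 0"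
      using N0[OF z] N by simp
    ultimately show ?thesis
      by (metis has_field_derivative_at_within)
  qed
  then have "\<exists>k. \<forall>z\<in>S. J z - of_int N * z = k"
    by (rule has_field_derivative_zero_constant[OF S(2)])
  then obtain k where k: "\<And>z. z \<in> S \<Longrightarrow> J z - of_int N * z = k"
    by blast
  have "cmean h w (exp x) = N * x + (Re k - c)" if x: "\<bar>x - ln t\<bar> < e" for x :: real
  proof -
    have inS: "of_real x + ?p * of_real y \<in> S" for y
      using x by (auto simp: S_def)
    have "path_image (linepath (of_real x) (of_real x + ?p)) \<subseteq> S"
      using inS[of 0] inS[of 1] S(2) by (simp add: closed_segment_subset)
    then have "(G has_contour_integral (\<Phi> (of_real x + ?p) - \<Phi> (of_real x))) (linepath (of_real x) (of_real x + ?p))"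
      using contour_integral_primitive[of S \<Phi> G "linepath (of_real x) (of_real x + ?p)"] \<Phi> by simp
    then have "((\<lambda>y. G (linepath (of_real x) (of_real x + ?p) y) * ?p) has_integral (\<Phi> (of_real x + ?p) - \<Phi> (of_real x))) {0..1}"
      by (simp add: has_contour_integral_linepath)
    then have "((\<lambda>y. G (linepath (of_real x) (of_real x + ?p) y) * ?p * inverse ?p) has_integral (\<Phi> (of_real x + ?p) - \<Phi> (of_real x)) * inverse ?p) {0..1}"
      by (rule has_integral_mult_left)
    moreover have "a * ?p * inverse ?p = a" for a
      using right_inverse[of ?p] by (simp only: mult.assoc) simp
    moreover have "(\<Phi> (of_real x + ?p) - \<Phi> (of_real x)) * inverse ?p = J (of_real x)"
      unfolding J_def by (rule divide_inverse[symmetric])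
    ultimately have "((\<lambda>y. G (linepath (of_real x) (of_real x + ?p) y)) has_integral J (of_real x)) {0..1}"
      by (simp only:)
    moreover have "linepath (of_real x) (of_real x + ?p) y = of_real x + ?p * of_real y" for y
      by (simp add: linepath_def algebra_simps scaleR_conv_of_real)
    ultimately have "((\<lambda>y. G (of_real x + ?p * of_real y)) has_integral J (of_real x)) {0..1}"
      by simp
    then have "((\<lambda>y. Re (G (of_real x + ?p * of_real y))) has_integral Re (J (of_real x))) {0..1}"
      using has_integral_linear[OF _ bounded_linear_Re] by (auto simp: o_def)
    then have *: "((\<lambda>y. Re (G (of_real x + ?p * of_real y)) - c) has_integral Re (J (of_real x)) - c) {0..1}"
      using has_integral_diff[OF _ has_integral_const_real[of c 0 1]] by simp
    have "h (circlepath w (exp x) y) = Re (G (of_real x + ?p * of_real y)) - c" for y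
    proof -
      have "circlepath w (exp x) y = w + exp (of_real x + ?p * of_real y)"
        by (simp add: circlepath exp_add exp_of_real)
      then show ?thesis
        using inD[OF inS[of y]] G(2)[OF inS[of y]] h_eq by simp
    qed
    then have "cmean h w (exp x) = Re (J (of_real x)) - c"
      unfolding cmean_def using integral_unique[OF *] by simp
    also have "J (of_real x) = k + of_int N * of_real x"
      using k[of "of_real x"] inS[of 0] by (simp add: algebra_simps)
    finally show ?thesis
      by simp
  qed
  then show ?thesis
    by (rule that[OF e(1)])
qed

lemma circle_supporting_slope:
  assumes "sphere w t \<subseteq> D" and "t > 0"
  obtains N :: int where "\<And>s. s > 0 \<Longrightarrow> cmean h w s \<ge> cmean h w t + N * (ln s - ln t)"
proof (rule circle_slope[OF assms])
  fix N :: int and k e :: real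
  assume N: "e > 0" "\<And>x. \<bar>x - ln t\<bar> < e \<Longrightarrow> cmean h w (exp x) = real_of_int N * x + k"
  have "N * ln s + k \<le> cmean h w s" if "s > 0" for s
    using convex_on_supporting_line[OF convex_on_cmean_exp[OF subharmonic_h, of w] N(1), of "ln t" N k "ln s"] N(2) that by simp
  moreover have "cmean h w t = N * ln t + k"
    using N(2)[of "ln t"] N(1) \<open>t > 0\<close> by simp
  ultimately show thesis
    by (intro that[of N]) (auto simp: algebra_simps)
qed

lemma cmean_h_small_radius:
  assumes "w \<notin> D" "e > 0"
  obtains d where "d > 0" "\<And>s. 0 < s \<Longrightarrow> s < d \<Longrightarrow> cmean h w s \<le> e"
proof -
  have "isCont h w"
    using continuous_h by (simp add: continuous_on_eq_continuous_at)
  then obtain d where d: "d > 0" "\<And>x. dist x w < d \<Longrightarrow> dist (h x) (h w) < e"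
    using assms(2) unfolding continuous_at_eps_delta by blast
  have "cmean h w s \<le> e" if "0 < s" "s < d" for s
  proof -
    have "h x \<le> e" if "x \<in> sphere w s" for x
      using d(2)[of x] that \<open>s < d\<close> h_outside[OF assms(1)] by (auto simp: dist_commute dist_real_def)
    then show ?thesis
      using cmean_mono[of w s h "\<lambda>x. e"] continuous_on_h that by auto
  qed
  then show ?thesis
    using that d(1) by blast
qed

text \<open>If the integer slope at \<open>t\<close> were at most 0, its support line would keep the
  mean at small radii above the positive mean at \<open>t\<close>; but that mean tends to h w = 0.
  An integer above 0 is at least 1.\<close>

lemma circle_around_hole:
  assumes "sphere w t \<subseteq> D" and "t > 0" and "w \<notin> D" and "t \<le> s"
  shows "cmean h w s \<ge> cmean h w t + (ln s - ln t)"
proof -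
  obtain N :: int where N: "\<And>s. s > 0 \<Longrightarrow> cmean h w s \<ge> cmean h w t + N * (ln s - ln t)"
    using circle_supporting_slope[OF assms(1,2)] by blast
  have pos: "cmean h w t > 0"
    using cmean_h_pos assms by blast
  have "N \<ge> 1"
  proof (rule ccontr)
    assume "\<not> N \<ge> 1"
    then have "N \<le> 0" by simp
    obtain d where d: "d > 0" "\<And>s. 0 < s \<Longrightarrow> s < d \<Longrightarrow> cmean h w s \<le> cmean h w t / 2"
      using cmean_h_small_radius[OF \<open>w \<notin> D\<close>, of "cmean h w t / 2"] pos by auto
    define s where "s = min (d / 2) t"
    have s: "0 < s" "s < d" "s \<le> t"
      using d \<open>t > 0\<close> by (auto simp: s_def)
    have "real_of_int N * (ln s - ln t) \<ge> 0"
      using s \<open>N \<le> 0\<close> \<open>t > 0\<close> by (intro mult_nonpos_nonpos) auto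
    then show False
      using N[OF s(1)] d(2)[OF s(1,2)] pos by linarith
  qed
  then have "1 * (ln s - ln t) \<le> N * (ln s - ln t)"
    using assms by (intro mult_right_mono) auto
  then show ?thesis
    using N[of s] assms by auto
qed

end

subsection \<open>Holes and growth\<close>

context log_tract
begin

lemma subharmonic_on_h: "open S \<Longrightarrow> subharmonic_on S h"
  using subharmonic_h subharmonic_on_subset by blast

text \<open>Around a hole close to \<open>z\<^sub>0\<close> there would be a circle in \<^term>\<open>D\<close> on which \<^term>\<open>h\<close> almost attains the
  harmonic majorant. The mean of \<^term>\<open>h\<close> then grows at least like the logarithm of the radius
  beyond this circle, and overtakes the majorant.\<close>

lemma no_hole:
  assumes s: "s > 0" and Q: "Q holomorphic_on ball z0 (30 * s)" "Q z0 = 0"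
    and M: "\<And>z. z \<in> ball z0 (30 * s) \<Longrightarrow> \<bar>Re (Q z)\<bar> \<le> M" "h z0 \<ge> M + 2"
    and maj: "\<And>z. z \<in> ball z0 (30 * s) \<Longrightarrow> h z \<le> h z0 + Re (Q z) + 1 / 30"
  shows "ball z0 s \<subseteq> D"
proof (rule ccontr)
  assume "\<not> ball z0 s \<subseteq> D"
  then obtain w where "w \<in> ball z0 s" "w \<notin> D"
    by blast
  then have w: "dist z0 w < s" "w \<notin> D"
    by auto
  define k where "k = h z0 + 1 / 30"
  \<comment> \<open>The gap below the majorant: nonnegative, superharmonic on the disc, and equal to
    1/30 at \<open>z0\<close>.\<close>
  define v where "v z = k + Re (Q z) - h z" for z
  have sub: "cball w r \<subseteq> ball z0 (30 * s)" if "r \<le> 29 * s" for r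
  proof
    fix x assume "x \<in> cball w r"
    then show "x \<in> ball z0 (30 * s)"
      using that w dist_triangle[of z0 x w] by simp
  qed
  have cQ: "continuous_on S (\<lambda>z. Re (Q z))" if "S \<subseteq> ball z0 (30 * s)" for S
    using holomorphic_on_imp_continuous_on[OF Q(1)] that
    by (intro continuous_intros) (rule continuous_on_subset)
  \<comment> \<open>If every such circle contained a point with gap at least 2, the lower bound
    would give gap 2/40 > 1/30 at \<open>z0\<close>. On a circle with gap below 2, \<open>h\<close>
    is positive because h z0 >= M + 2.\<close>
  have "\<exists>t\<in>{s..2 * s}. \<forall>x. dist w x = t \<longrightarrow> v x < 2"
  proof (rule ccontr)
    assume "\<not> ?thesis"
    then have meet: "\<exists>x. dist w x = t \<and> v x \<ge> 2" if "t \<in> {s..2 * s}" for t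
      using that by (meson linorder_not_less)
    have "v z0 \<ge> 2 / 40"
    proof (rule superharmonic_lower_bound[OF s _ _ _ _ meet])
      show "continuous_on (cball w (10 * s)) v"
        unfolding v_def using sub[of "10 * s"] s by (intro continuous_intros cQ continuous_on_h) auto
      have "ball w (10 * s) \<subseteq> ball z0 (30 * s)"
        using sub[of "10 * s"] s ball_subset_cball[of w "10 * s"] by auto
      then have "Q holomorphic_on ball w (10 * s)"
        using Q(1) holomorphic_on_subset by blast
      then have "subharmonic_on (ball w (10 * s)) (\<lambda>z. (h z + Re (- Q z)) + (- k))"
        by (intro subharmonic_on_add subharmonic_on_h subharmonic_on_Re subharmonic_on_const
            holomorphic_intros) auto
      then show "subharmonic_on (ball w (10 * s)) (\<lambda>z. - v z)"
        by (simp add: v_def algebra_simps)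
      show "v x \<ge> 0" if "x \<in> cball w (10 * s)" for x
        using maj[of x] sub[of "10 * s"] that s by (auto simp: v_def k_def subset_iff)
      show "dist w z0 \<le> 2 * s"
        using w s by (simp add: dist_commute)
    qed auto
    then show False
      using Q(2) by (simp add: v_def k_def)
  qed
  then obtain t where t: "t \<in> {s..2 * s}" "\<And>x. dist w x = t \<Longrightarrow> v x < 2"
    by blast
  have t0: "0 < t"
    using t s by simp
  have tsub: "sphere w t \<subseteq> ball z0 (30 * s)" "sphere w (20 * s) \<subseteq> ball z0 (30 * s)"
    using sub[of t] sub[of "20 * s"] t s by (auto simp: subset_iff)
  have hole: "sphere w t \<subseteq> D"
  proof
    fix x assume x: "x \<in> sphere w t"
    then have "x \<in> ball z0 (30 * s)"
      using tsub by blast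
    from M(1)[OF this] M(2) t(2)[of x] x have "h x > 0"
      by (simp add: v_def k_def abs_le_iff)
    then show "x \<in> D"
      by (simp add: h_pos_iff)
  qed
  have mean: "cmean (\<lambda>z. Re (Q z) + a) w r = Re (Q w) + a" if "0 < r" "r \<le> 20 * s" for r a
  proof -
    have "ball w (25 * s) \<subseteq> ball z0 (30 * s)"
    proof
      fix x assume "x \<in> ball w (25 * s)"
      then show "x \<in> ball z0 (30 * s)"
        using w s dist_triangle[of z0 x w] by simp
    qed
    then have "Q holomorphic_on ball w (25 * s)"
      using Q(1) holomorphic_on_subset by blast
    then have "cmean (\<lambda>z. Re (Q z)) w r = Re (Q w)"
      using that s by (intro cmean_Re_holomorphic[of Q w "25 * s"]) auto
    moreover have "sphere w r \<subseteq> ball z0 (30 * s)"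
      using sub[of r] that s by (auto simp: subset_iff)
    ultimately show ?thesis
      using that by (subst cmean_add) (auto intro!: cQ)
  qed
  \<comment> \<open>The harmonic majorant has the same mean over both circles. The mean of
    \<open>h\<close> is at least this value minus 2 at radius \<open>t\<close> and at most this
    value at radius 20 s, yet in between it gains at least ln 10 > 2, as 20 s >= 10 t.\<close>
  have "Re (Q w) + (k - 2) = cmean (\<lambda>z. Re (Q z) + (k - 2)) w t"
    using mean[of t] t t0 by simp
  also have "\<dots> \<le> cmean h w t"
    using t(2) t0 tsub by (intro cmean_mono continuous_intros cQ continuous_on_h) (force simp: v_def)+
  also have "\<dots> \<le> cmean h w (20 * s) - (ln (20 * s) - ln t)"
    using circle_around_hole[OF hole t0 w(2), of "20 * s"] t s by auto
  also have "cmean h w (20 * s) \<le> cmean (\<lambda>z. Re (Q z) + k) w (20 * s)"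
  proof (rule cmean_mono[OF continuous_on_h])
    show "continuous_on (sphere w (20 * s)) (\<lambda>z. Re (Q z) + k)"
      by (intro continuous_on_add continuous_on_const cQ tsub)
    fix x assume "x \<in> sphere w (20 * s)"
    then have "x \<in> ball z0 (30 * s)"
      using tsub by blast
    then show "h x \<le> Re (Q x) + k"
      using maj[of x] by (simp add: k_def)
  qed (use s in auto)
  also have "\<dots> = Re (Q w) + k"
    using mean[of "20 * s"] s by simp
  finally have "ln (20 * s) - ln t \<le> 2"
    by simp
  moreover have "ln (20 * s) - ln t \<ge> ln 10"
  proof -
    have "ln (10 * t) \<le> ln (20 * s)"
      using t t0 by (subst ln_le_cancel_iff) auto
    then show ?thesis
      using t0 by (simp add: ln_mult)
  qed
  moreover have "ln (10::real) > 2"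
  proof -
    have "exp (2::real) = exp 1 * exp 1"
      by (simp add: exp_add[symmetric])
    also have "\<dots> \<le> 3 * 3"
      using exp_le by (intro mult_mono) auto
    finally have "exp 2 < (10::real)"
      by simp
    then show ?thesis
      by (metis exp_less_cancel_iff exp_ln_iff zero_less_numeral)
  qed
  ultimately show False
    by linarith
qed

section \<open>Excluding logarithmic growth\<close>

lemma h_le_on_cball:
  assumes "\<And>x. dist w x = s \<Longrightarrow> h x \<le> b" "dist w x \<le> s"
  shows "h x \<le> b"
proof -
  have "0 \<le> s"
    using assms(2) by (rule order_trans[OF zero_le_dist])
  then obtain z where z: "dist w z = s" "h z = maxmod h w s"
    using maxmod_attained[OF continuous_h] by blast
  have "h x \<le> maxmod h w (dist w x)"
    by (rule le_maxmod[OF continuous_h])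
  also have "\<dots> \<le> maxmod h w s"
    by (intro maxmod_mono_radius subharmonic_h assms) simp
  finally show ?thesis
    using assms(1)[OF z(1)] z(2) by simp
qed

text \<open>Apply \<open>superharmonic_lower_bound\<close> to b - h, which equals \<open>b\<close>
  off \<open>D\<close> and so is at least \<open>b\<close> somewhere on each circle.\<close>

lemma decay_if_all_circles_meet_complement:
  assumes meet: "\<And>t. t \<ge> s0 \<Longrightarrow> \<not> sphere w t \<subseteq> D" and "s0 > 0" "s0 \<le> s" "b > 0"
    and b: "\<And>x. dist w x \<le> 10 * s \<Longrightarrow> h x \<le> b" and x: "dist w x \<le> s"
  shows "h x \<le> 39 / 40 * b"
proof -
  have "b - h x \<ge> b / 40"
  proof (rule superharmonic_lower_bound[of s w "\<lambda>x. b - h x"])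
    show "continuous_on (cball w (10 * s)) (\<lambda>x. b - h x)"
      by (intro continuous_intros continuous_on_h)
    have "subharmonic_on (ball w (10 * s)) (\<lambda>x. h x + - b)"
      by (intro subharmonic_on_add subharmonic_on_h subharmonic_on_const) auto
    then show "subharmonic_on (ball w (10 * s)) (\<lambda>x. - (b - h x))"
      by simp
    show "\<exists>x. dist w x = t \<and> b \<le> b - h x" if "t \<in> {s..2 * s}" for t
      using meet[of t] that assms(3) h_outside by (force simp: subset_iff)
  qed (use assms in auto)
  then show ?thesis by simp
qed

text \<open>Iterating the decay from radius 10^n s down to \<open>s\<close> multiplies the bound by
  (39/40)^n, while a logarithmic bound at radius 10^n s grows only linearly in n. In the limit
  \<open>h\<close> would vanish on \<open>D\<close>.\<close>

lemma not_all_circles_meet_complement: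
  assumes "s0 > 0" "D \<noteq> {}" and A: "0 \<le> A" "0 \<le> B"
    and bound: "\<And>s x. s \<ge> s0 \<Longrightarrow> dist w x \<le> s \<Longrightarrow> h x \<le> A * ln s + B"
  shows "\<exists>t\<ge>s0. sphere w t \<subseteq> D"
proof (rule ccontr)
  assume "\<not> ?thesis"
  then have meet: "\<And>t. t \<ge> s0 \<Longrightarrow> \<not> sphere w t \<subseteq> D"
    by blast
  have iter: "h x \<le> (39 / 40) ^ n * b"
    if "s0 \<le> s" "b > 0" "\<And>x. dist w x \<le> 10 ^ n * s \<Longrightarrow> h x \<le> b" "dist w x \<le> s" for n s b x
    using that
  proof (induction n arbitrary: b)
    case (Suc n)
    have s: "s0 \<le> 10 ^ n * s"
    proof -
      have "1 * s \<le> 10 ^ n * s"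
        using \<open>s0 > 0\<close> \<open>s0 \<le> s\<close> by (intro mult_right_mono) auto
      then show ?thesis
        using \<open>s0 \<le> s\<close> by simp
    qed
    have "h y \<le> 39 / 40 * b" if "dist w y \<le> 10 ^ n * s" for y
      by (rule decay_if_all_circles_meet_complement[OF meet \<open>s0 > 0\<close> s \<open>b > 0\<close> _ that])
         (use Suc.prems(3) in \<open>simp_all add: mult.assoc\<close>)
    then have "h x \<le> (39 / 40) ^ n * (39 / 40 * b)"
      using Suc.prems by (intro Suc.IH) auto
    then show ?case
      by (simp add: mult.assoc mult.left_commute)
  qed auto
  obtain x where x: "x \<in> D"
    using \<open>D \<noteq> {}\<close> by blast
  define s where "s = max (max s0 1) (dist w x)"
  have s: "s0 \<le> s" "1 \<le> s" "dist w x \<le> s"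
    by (auto simp: s_def)
  have "h x \<le> A * ln 10 * (real n * (39 / 40) ^ n) + (A * ln s + B + 1) * (39 / 40) ^ n" for n
  proof -
    have "1 * s \<le> 10 ^ n * s"
      using s by (intro mult_right_mono) auto
    then have le: "s0 \<le> 10 ^ n * s"
      using s by linarith
    have "ln (10 ^ n * s) = n * ln 10 + ln s"
      using s by (simp add: ln_mult ln_realpow)
    then have "h y \<le> A * (n * ln 10 + ln s) + B + 1" if "dist w y \<le> 10 ^ n * s" for y
      using bound[OF le that] by simp
    moreover have "A * (n * ln 10 + ln s) + B + 1 > 0"
      using A s by (intro add_nonneg_pos add_nonneg_nonneg mult_nonneg_nonneg) auto
    ultimately have "h x \<le> (39 / 40) ^ n * (A * (n * ln 10 + ln s) + B + 1)"
      using s by (intro iter[of s]) auto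
    then show ?thesis
      by (simp add: algebra_simps)
  qed
  moreover have "(\<lambda>n. A * ln 10 * (real n * (39 / 40) ^ n) + (A * ln s + B + 1) * (39 / 40) ^ n) \<longlonglongrightarrow>
      A * ln 10 * 0 + (A * ln s + B + 1) * 0"
    by (intro tendsto_intros powser_times_n_limit_0 LIMSEQ_realpow_zero) auto
  ultimately have "h x \<le> A * ln 10 * 0 + (A * ln s + B + 1) * 0"
    by (intro LIMSEQ_le_const) auto
  then show False
    using h_pos[OF x] by simp
qed

text \<open>If all slopes were bounded, then by integrality the mean would eventually be linear in the
  logarithm of the radius. Replacing \<^term>\<open>h\<close> by its maximum with a small constant leaves it
  unchanged on two circles but increases it on the hole between them, against convexity.\<close>

lemma slopes_unbounded:
  assumes good: "\<And>s. \<exists>t\<ge>s. sphere w t \<subseteq> D" and unb: "\<not> bounded (- D)"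
  shows "\<exists>s\<ge>s0. cmean h w s > A * ln s + B"
proof (rule ccontr)
  assume "\<not> ?thesis"
  then have bound: "\<And>s. s \<ge> s0 \<Longrightarrow> cmean h w s \<le> A * ln s + B"
    by (meson linorder_not_less)
  define P where "P t N \<longleftrightarrow> t > 0 \<and> sphere w t \<subseteq> D \<and>
      (\<forall>s>0. cmean h w s \<ge> cmean h w t + real_of_int N * (ln s - ln t))" for t N
  have ex: "\<exists>t N. t \<ge> s \<and> P t N" for s
  proof -
    obtain t where t: "t \<ge> max s 1" "sphere w t \<subseteq> D"
      using good by blast
    then have "t > 0" by simp
    then show ?thesis
      unfolding P_def using circle_supporting_slope[OF t(2)] t by (metis max.bounded_iff)
  qed
  have le_A: "real_of_int N \<le> A" if N: "P t N" for t N
  proof (rule ccontr)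
    assume "\<not> real_of_int N \<le> A"
    then have pos: "real_of_int N - A > 0"
      by simp
    define x where "x = max (ln (max s0 1)) ((B - cmean h w t + N * ln t) / (real_of_int N - A) + 1)"
    have "exp x \<ge> exp (ln (max s0 1))"
      unfolding exp_le_cancel_iff x_def by (rule max.cobounded1)
    moreover have "exp (ln (max s0 1)) = max s0 1"
      by (rule exp_ln) simp
    ultimately have "exp x \<ge> s0"
      by linarith
    then have "cmean h w t + N * (x - ln t) \<le> A * x + B"
      using bound[of "exp x"] N unfolding P_def by (metis exp_gt_zero ln_exp order_trans)
    then have "(real_of_int N - A) * x \<le> B - cmean h w t + N * ln t"
      by (simp add: algebra_simps)
    then have "x \<le> (B - cmean h w t + N * ln t) / (real_of_int N - A)"
      using pos by (simp add: field_simps)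
    then show False
      by (simp add: x_def)
  qed
  obtain t0 N where t0: "P t0 N" and max: "\<And>t N'. P t N' \<Longrightarrow> N' \<le> N"
  proof -
    obtain t1 N1 where "P t1 N1"
      using ex by blast
    then have "\<exists>t. P t N1" by blast
    \<comment> \<open>All these slopes are integers at most \<open>A\<close>, so a largest one
      exists; it is found by minimizing the natural number floor A - N.\<close>
    then obtain N where N: "\<exists>t. P t N" "\<And>N'. \<exists>t. P t N' \<Longrightarrow> nat (\<lfloor>A\<rfloor> - N) \<le> nat (\<lfloor>A\<rfloor> - N')"
      using ex_has_least_nat[of "\<lambda>N. \<exists>t. P t N" N1 "\<lambda>N. nat (\<lfloor>A\<rfloor> - N)"] by blast
    have "N' \<le> N" if "P t N'" for t N'
      using N(2)[of N'] that le_A[OF that] by (auto simp: le_floor_iff nat_le_eq_zle)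
    then show ?thesis
      using that N(1) by blast
  qed
  obtain w' where w': "w' \<notin> D" "dist w w' > t0"
    using unb unfolding bounded_def by (meson ComplD Compl_iff linorder_not_less)
  obtain t1 N1 where t1: "t1 \<ge> dist w w' + 1" "P t1 N1"
    using ex by blast
  have t01: "0 < t0" "t0 < t1" "0 < t1" "ln t0 < ln t1"
    using t0 t1 w' by (auto simp: P_def)
  define s where "s = dist w w'"
  have s: "t0 < s" "s < t1" "0 < s"
    using w' t1 t01 by (auto simp: s_def)
  have A1: "cmean h w t1 \<ge> cmean h w t0 + N * (ln t1 - ln t0)"
    using t0 t01 by (auto simp: P_def)
  have "N1 \<le> N"
    by (rule max[OF t1(2)])
  then have "real_of_int N1 * (ln t1 - ln t0) \<le> N * (ln t1 - ln t0)"
    using t01 by (intro mult_right_mono) auto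
  moreover have "cmean h w t0 \<ge> cmean h w t1 + N1 * (ln t0 - ln t1)"
    using t1 t01 by (auto simp: P_def)
  \<comment> \<open>The slope at \<open>t1\<close> does not exceed the maximal slope
    \<open>N\<close> at \<open>t0\<close>, so the support inequalities in the two directions pinch
    to an equality.\<close>
  ultimately have A2: "cmean h w t1 = cmean h w t0 + N * (ln t1 - ln t0)"
    using A1 by (simp add: algebra_simps)
  have As: "cmean h w s \<ge> cmean h w t0 + N * (ln s - ln t0)"
    using t0 s by (auto simp: P_def)
  obtain \<eta> where \<eta>: "\<eta> > 0" "\<And>x. x \<in> sphere w t0 \<union> sphere w t1 \<Longrightarrow> \<eta> \<le> h x"
  proof -
    have "compact (sphere w t0 \<union> sphere w t1)" "sphere w t0 \<union> sphere w t1 \<noteq> {}"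
      using t01 by (auto intro: compact_Un)
    then obtain y where y: "y \<in> sphere w t0 \<union> sphere w t1" "\<forall>x \<in> sphere w t0 \<union> sphere w t1. h y \<le> h x"
      using continuous_attains_inf[OF _ _ continuous_on_h] by blast
    then have "h y > 0"
      using t0 t1(2) by (auto simp: P_def intro!: h_pos)
    then show ?thesis
      using y that by blast
  qed
  define u where "u x = max (h x) \<eta>" for x
  have u: "subharmonic_on UNIV u"
    unfolding u_def by (intro subharmonic_on_max subharmonic_h subharmonic_on_const) auto
  have u0: "cmean u w t0 = cmean h w t0" "cmean u w t1 = cmean h w t1"
    using \<eta> t01 by (auto intro!: cmean_cong simp: u_def)
  define \<theta> where "\<theta> = (ln s - ln t0) / (ln t1 - ln t0)"
  have \<theta>: "0 \<le> \<theta>" "\<theta> \<le> 1"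
    using s t01 by (auto simp: \<theta>_def divide_simps)
  have \<theta>': "\<theta> * (ln t1 - ln t0) = ln s - ln t0"
    using t01 by (simp add: \<theta>_def)
  have "(1 - \<theta>) * ln t0 + \<theta> * ln t1 = ln s"
    using \<theta>' by (simp add: algebra_simps)
  then have "cmean u w s \<le> (1 - \<theta>) * cmean u w t0 + \<theta> * cmean u w t1"
    using convex_onD[OF convex_on_cmean_exp[OF u, of w] \<theta>, of "ln t0" "ln t1"] t01 s by simp
  also have "\<dots> = cmean h w t0 + N * (\<theta> * (ln t1 - ln t0))"
    unfolding u0 A2 by (simp add: algebra_simps)
  also have "\<dots> \<le> cmean h w s"
    using As \<theta>' by simp
  finally have "h w' = u w'"
    using s continuous_on_h subharmonic_on_continuous[OF u]
    by (intro cmean_eq_imp_eq[of w s h u]) (auto simp: u_def s_def intro: continuous_on_subset)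
  then show False
    using h_outside[OF w'(1)] \<eta> by (simp add: u_def)
qed

text \<open>A logarithmic bound yields arbitrarily large circles inside \<open>D\<close> by
  \<open>not_all_circles_meet_complement\<close>; then \<open>slopes_unbounded\<close> contradicts
  the same bound for the means.\<close>

lemma growth_not_logarithmic:
  assumes "D \<noteq> {}" and unb: "\<not> bounded (- D)"
  shows "\<exists>z. norm z \<ge> 1 \<and> h z > A * ln (norm z) + B"
proof (rule ccontr)
  assume "\<not> ?thesis"
  then have le: "h z \<le> A * ln (norm z) + B" if "norm z \<ge> 1" for z
    using that by (meson linorder_not_less)
  obtain w where "w \<notin> D"
    using unb by (metis Compl_UNIV_eq bounded_empty UNIV_eq_I)
  define s0 where "s0 = norm w + 1"
  define B' where "B' = \<bar>A\<bar> * ln 2 + \<bar>B\<bar>"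
  have s0: "s0 > 0" "s0 \<ge> 1"
    by (auto simp: s0_def add_nonneg_pos)
  have bound: "h x \<le> \<bar>A\<bar> * ln s + B'" if s: "s \<ge> s0" and x: "dist w x \<le> s" for s x
  proof (rule h_le_on_cball[OF _ x])
    fix y assume y: "dist w y = s"
    have "norm y \<le> s + norm w" "norm y \<ge> s - norm w"
      using y norm_triangle_ineq4[of y w] norm_triangle_ineq2[of w y] norm_triangle_ineq[of "y - w" w]
        norm_triangle_ineq4[of w y]
      by (auto simp: dist_norm norm_minus_commute)
    then have ny: "norm y \<le> 2 * s" "norm y \<ge> 1"
      using s by (auto simp: s0_def)
    then have "ln (norm y) \<le> ln (2 * s)"
      by (intro ln_mono) auto
    moreover have "0 \<le> ln (norm y)"
      using ny by simp
    moreover have "0 \<le> ln (2 * s)"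
      using s s0 by simp
    ultimately have "A * ln (norm y) \<le> \<bar>A\<bar> * ln (2 * s)"
      by (intro mult_mono) auto
    also have "\<dots> = \<bar>A\<bar> * ln s + \<bar>A\<bar> * ln 2"
      using s s0 by (simp add: ln_mult algebra_simps)
    finally show "h y \<le> \<bar>A\<bar> * ln s + B'"
      using le[OF ny(2)] by (simp add: B'_def)
  qed
  have good: "\<exists>t\<ge>s. sphere w t \<subseteq> D" for s
  proof -
    have "\<exists>t\<ge>max s s0. sphere w t \<subseteq> D"
      using s0 assms(1) bound
      by (intro not_all_circles_meet_complement[where A = "\<bar>A\<bar>" and B = B']) (auto simp: B'_def)
    then show ?thesis by auto
  qed
  obtain s where s: "s \<ge> s0" "cmean h w s > \<bar>A\<bar> * ln s + B'"
    using slopes_unbounded[OF good unb] by blast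
  have "cmean h w s \<le> cmean (\<lambda>x. \<bar>A\<bar> * ln s + B') w s"
    using bound[OF s(1)] s s0 by (intro cmean_mono continuous_on_h) auto
  then show False
    using s by simp
qed

text \<open>The maximum over circles is convex in the logarithm of the radius, so growth faster than
  logarithmic makes its slope exceed any constant eventually. The drop by \<open>L\<close> inside
  radius exp (x + 1/4) later keeps a maximum point away from the inner edge of an annulus.\<close>

lemma rapid_growth:
  assumes "D \<noteq> {}" and "\<not> bounded (- D)"
  obtains X where "\<And>x. x \<ge> X \<Longrightarrow> \<exists>z. norm z = exp (x + 1/2) \<and> h z \<ge> x + L \<and>
    (\<forall>y. norm y \<le> exp (x + 1/4) \<longrightarrow> h y \<le> h z - L)"
proof -
  \<comment> \<open>Over a logarithmic step of 1/4 slope \<open>K\<close> gains at least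
    \<open>L\<close>; the summand 2 gives h z >= 2 x, which is at least x + L once x >= |L|.\<close>
  define K where "K = 4 * \<bar>L\<bar> + 2"
  define g where "g x = maxmod h 0 (exp x)" for x
  have g: "convex_on UNIV g"
    unfolding g_def by (rule convex_on_maxmod_exp[OF subharmonic_h])
  have hg: "h y \<le> g x" if "norm y \<le> exp x" for x y
  proof -
    have "h y \<le> maxmod h 0 (dist 0 y)"
      by (rule le_maxmod[OF continuous_h])
    also have "\<dots> \<le> g x"
      unfolding g_def using that by (intro maxmod_mono_radius subharmonic_h) auto
    finally show ?thesis .
  qed
  obtain z0 where z0: "norm z0 \<ge> 1" "h z0 > K * ln (norm z0) + g 0"
    using growth_not_logarithmic[OF assms] by blast
  define x1 where "x1 = ln (norm z0)"
  have "h z0 \<le> g x1"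
  proof (rule hg)
    have "norm z0 > 0"
      using z0(1) by linarith
    then show "norm z0 \<le> exp x1"
      by (simp add: x1_def)
  qed
  then have gx1: "g x1 > K * x1 + g 0"
    using z0 by (simp add: x1_def)
  moreover have "x1 \<ge> 0"
    using z0 by (simp add: x1_def)
  ultimately have x1: "x1 > 0"
    by (cases "x1 = 0") auto
  have slope0: "(g x - g 0) / x \<ge> K" if "x > x1" for x
  proof -
    have "K \<le> (g 0 - g x1) / (0 - x1)"
      using gx1 x1 by (simp add: field_simps)
    also have "\<dots> \<le> (g 0 - g x) / (0 - x)"
      using that x1 by (intro convex_on_slope_le(1)[OF g]) auto
    also have "\<dots> = (g x - g 0) / x"
      using that x1 by (simp add: field_simps)
    finally show ?thesis .
  qed
  have slope: "g y - g x \<ge> K * (y - x)" if "x > x1" "y > x" for x y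
  proof -
    have "K \<le> (g 0 - g y) / (0 - y)"
      using slope0[of y] that x1 by (simp add: field_simps)
    also have "\<dots> \<le> (g x - g y) / (x - y)"
      using that x1 by (intro convex_on_slope_le(2)[OF g]) auto
    finally show ?thesis
      using that by (simp add: field_simps)
  qed
  show ?thesis
  proof (rule that[of "max (x1 + 1) \<bar>L\<bar>"])
    fix x assume x: "x \<ge> max (x1 + 1) \<bar>L\<bar>"
    then have x': "x > x1" "x \<ge> \<bar>L\<bar>" "x > 0"
      using x1 by auto
    obtain z where z: "dist 0 z = exp (x + 1/2)" "h z = g (x + 1/2)"
      unfolding g_def using maxmod_attained[OF continuous_h] by (metis exp_ge_zero)
    have "h y \<le> h z - L" if "norm y \<le> exp (x + 1/4)" for y
    proof -
      have "g (x + 1/2) - g (x + 1/4) \<ge> K * ((x + 1/2) - (x + 1/4))"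
        using x' by (intro slope) auto
      then show ?thesis
        using hg[OF that] z(2) by (simp add: K_def)
    qed
    moreover have "h z \<ge> x + L"
    proof -
      have "K * (x + 1/2) \<le> g (x + 1/2) - g 0"
        using slope0[of "x + 1/2"] x' by (simp add: field_simps)
      moreover have "g 0 \<ge> 0"
        using hg[of 0 0] h_nonneg[of 0] by simp
      moreover have "2 * x \<le> K * (x + 1/2)"
        using x' by (intro mult_mono) (auto simp: K_def)
      ultimately show ?thesis
        using z(2) x' by linarith
    qed
    ultimately show "\<exists>z. norm z = exp (x + 1/2) \<and> h z \<ge> x + L \<and> (\<forall>y. norm y \<le> exp (x + 1/4) \<longrightarrow> h y \<le> h z - L)"
      using z by auto
  qed
qed

end

subsection \<open>Covering of annuli and escaping orbits\<close>

context log_tract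
begin

text \<open>Raising the threshold gives a tract of the same kind. A hole-free disc found in it
  carries the bound ln|f| > c + k, which pushes the next annulus outwards.\<close>

lemma truncation:
  assumes "k \<ge> 0"
  shows "log_tract {z. h z > k} f (\<lambda>z. max (h z - k) 0) (c + k)"
proof
  have sub: "{z. h z > k} \<subseteq> D"
    using assms h_pos_iff by (auto intro: order_le_less_trans)
  show "open {z. h z > k}"
    by (intro open_Collect_less continuous_on_const continuous_h)
  show "f holomorphic_on {z. h z > k}"
    using holomorphic sub holomorphic_on_subset by blast
  show "continuous_on UNIV (\<lambda>z. max (h z - k) 0)"
    by (intro continuous_intros continuous_h)
  show "f z \<noteq> 0" "max (h z - k) 0 = ln (norm (f z)) - (c + k)" "max (h z - k) 0 > 0"
    if "z \<in> {z. h z > k}" for z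
    using that sub nonzero h_eq by auto
  show "max (h z - k) 0 = 0" if "z \<notin> {z. h z > k}" for z
    using that by auto
qed

end

section \<open>Estimates for the barrier, and covering by Bloch's theorem\<close>

lemma ln_norm_le_iff:
  assumes "z \<noteq> 0"
  shows "ln (norm z) \<le> y \<longleftrightarrow> norm z \<le> exp y"
  using assms exp_le_cancel_iff[of "ln (norm z)" y] by simp

text \<open>The remainder beyond the tangent of lam / (t - d) at d = 0 is exactly lam d^2 / (t^2 (t
  - d)), and t - d >= t/2.\<close>

lemma barrier_taylor:
  fixes lam t d :: real
  assumes "lam > 0" "t > 0" "\<bar>d\<bar> \<le> t / 2"
  shows "lam / (t - d) - lam / t \<le> lam / t\<^sup>2 * d + 2 * lam * d\<^sup>2 / t ^ 3"
proof -
  have td: "t - d \<ge> t / 2" "t - d > 0"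
    using assms by (auto simp: abs_le_iff)
  have "lam / (t - d) - lam / t - lam / t\<^sup>2 * d = lam * d\<^sup>2 / (t\<^sup>2 * (t - d))"
    using td assms by (simp add: divide_simps) (simp add: algebra_simps power2_eq_square power3_eq_cube)
  also have "\<dots> \<le> lam * d\<^sup>2 / (t\<^sup>2 * (t / 2))"
    using td assms by (intro divide_left_mono mult_left_mono mult_pos_pos mult_nonneg_nonneg) auto
  also have "\<dots> = 2 * lam * d\<^sup>2 / t ^ 3"
    using assms by (simp add: power2_eq_square power3_eq_cube)
  finally show ?thesis
    by linarith
qed

lemma abs_ln_norm_add_le:
  assumes "norm (\<zeta>::complex) \<le> \<rho>" "\<rho> \<le> 1/2"
  shows "\<bar>ln (norm (1 + \<zeta>))\<bar> \<le> 2 * \<rho>"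
proof -
  have \<rho>: "0 \<le> \<rho>"
    using assms(1) norm_ge_zero order_trans by blast
  have lo: "1 - \<rho> \<le> norm (1 + \<zeta>)" and up: "norm (1 + \<zeta>) \<le> 1 + \<rho>"
    using assms norm_triangle_ineq[of 1 \<zeta>] norm_diff_ineq[of 1 \<zeta>] by auto
  have pos: "0 < norm (1 + \<zeta>)"
    using lo assms by linarith
  have "ln (norm (1 + \<zeta>)) \<le> ln (1 + \<rho>)"
    using up pos by (intro ln_mono) auto
  also have "\<dots> \<le> \<rho>"
    using \<rho> by (rule ln_add_one_self_le_self)
  finally have "ln (norm (1 + \<zeta>)) \<le> 2 * \<rho>"
    using \<rho> by linarith
  moreover have "- (2 * \<rho>) \<le> - \<rho> - 2 * \<rho>\<^sup>2"
    using \<rho> assms(2) mult_left_mono[of "2 * \<rho>" 1 \<rho>] by (simp add: power2_eq_square)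
  then have "- (2 * \<rho>) \<le> ln (norm (1 + \<zeta>))"
    using ln_one_minus_pos_lower_bound[OF \<rho> assms(2)] ln_mono[OF lo] assms(2) by simp
  ultimately show ?thesis
    by simp
qed

text \<open>Bloch's theorem with constant 1/12 turns 60 into an image disc of radius 5. As 5 > pi +
  1/2, it contains a rectangle of width 1 and height 2 pi, which \<open>exp\<close> maps over a full
  annulus.\<close>

lemma annulus_covering:
  assumes g: "g holomorphic_on ball z r" and "r > 0" and big: "r * norm (deriv g z) \<ge> 60"
    and low: "\<And>x. x \<in> ball z r \<Longrightarrow> Re (g x) > y"
  obtains x where "x \<ge> y" "\<And>w. exp x \<le> norm w \<Longrightarrow> norm w \<le> exp (x + 1) \<Longrightarrow> \<exists>\<zeta>\<in>ball z r. exp (g \<zeta>) = w"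
proof -
  obtain b where b: "ball b 5 \<subseteq> g ` ball z r"
    using Bloch[OF g \<open>r > 0\<close>, of 5] big by auto
  show ?thesis
  proof (rule that[of "Re b - 1/2"])
    have "b - 1/2 \<in> ball b 5"
      by (simp add: dist_norm)
    then have "b - 1/2 \<in> g ` ball z r"
      by (rule subsetD[OF b])
    then obtain \<zeta> where "\<zeta> \<in> ball z r" "g \<zeta> = b - 1/2"
      by (elim imageE) simp
    then show "y \<le> Re b - 1/2"
      using low[of \<zeta>] by simp
  next
    fix w :: complex assume w: "exp (Re b - 1/2) \<le> norm w" "norm w \<le> exp (Re b - 1/2 + 1)"
    have "norm w > 0"
      using w(1) exp_gt_zero by (rule order_less_le_trans[rotated])
    then have w0: "w \<noteq> 0" by auto
    define l where "l = Ln (w / exp b)"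
    have el: "exp (b + l) = w"
      using w0 by (simp add: l_def exp_add)
    have "Re l = ln (norm w) - Re b"
      using w0 by (simp add: l_def norm_divide ln_div)
    moreover have "ln (norm w) \<ge> Re b - 1/2"
      using w(1) \<open>norm w > 0\<close> by (simp add: ln_ge_iff)
    moreover have "ln (norm w) \<le> Re b - 1/2 + 1"
      using w(2) \<open>norm w > 0\<close> by (metis ln_exp ln_mono)
    ultimately have "\<bar>Re l\<bar> \<le> 1/2"
      by linarith
    moreover have "\<bar>Im l\<bar> \<le> pi"
      using w0 mpi_less_Im_Ln[of "w / exp b"] Im_Ln_le_pi[of "w / exp b"] by (auto simp: l_def abs_le_iff)
    ultimately have "norm l < 5"
      using cmod_le[of l] pi_less_4 by linarith
    then have "b + l \<in> ball b 5"
      by (simp add: dist_norm)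
    then have "b + l \<in> g ` ball z r"
      by (rule subsetD[OF b])
    then obtain \<zeta> where "\<zeta> \<in> ball z r" "g \<zeta> = b + l"
      by (elim imageE) simp
    then show "\<exists>\<zeta>\<in>ball z r. exp (g \<zeta>) = w"
      using el by metis
  qed
qed

context log_tract
begin

text \<open>The barrier \<open>lam / (x + 1 - log|z|)\<close> replaces the central index of Wiman--Valiron theory: at a
  maximum point of \<^term>\<open>h\<close> minus the barrier, \<^term>\<open>h\<close> is bounded in a disc of radius comparable to
  \<open>|z| / a\<close> by \<open>a log|z|\<close> up to a constant and a small error, \<open>a\<close> being the slope of the barrier.\<close>

lemma covering_step:
  assumes "D \<noteq> {}" and "\<not> bounded (- D)"
  obtains X :: real where "\<And>x. x \<ge> X \<Longrightarrow> \<exists>K y. compact K \<and> K \<subseteq> D \<and> K \<subseteq> {z. exp x \<le> norm z \<and> norm z \<le> exp (x + 1)} \<and>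
    y \<ge> x + 1 \<and> {w. exp y \<le> norm w \<and> norm w \<le> exp (y + 1)} \<subseteq> f ` K"
proof -
  \<comment> \<open>Large enough that the quadratic error of the barrier on the disc of radius 30 s,
    at most 2 * 7200^2 * \<tau> / lam, is no more than 1/30.\<close>
  define lam :: real where "lam = 10 ^ 10"
  \<comment> \<open>2 lam is the barrier at \<open>z1\<close>, whose logarithmic radius is 1/2 short
    of x1; the rest leaves \<open>h\<close> at least 7202 above the threshold \<open>k\<close> at
    the maximum point.\<close>
  define L where "L = 2 * lam + \<bar>c\<bar> + 10000"
  obtain X0 where X0: "\<And>x. x \<ge> X0 \<Longrightarrow> \<exists>z. norm z = exp (x + 1/2) \<and> h z \<ge> x + L \<and>
      (\<forall>y. norm y \<le> exp (x + 1/4) \<longrightarrow> h y \<le> h z - L)"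
    using rapid_growth[OF assms, of L] by blast
  show ?thesis
  proof (rule that[of "max X0 0"])
    fix x assume x: "x \<ge> max X0 0"
    then obtain z1 where z1: "norm z1 = exp (x + 1/2)" "h z1 \<ge> x + L"
      "\<And>y. norm y \<le> exp (x + 1/4) \<Longrightarrow> h y \<le> h z1 - L"
      using X0[of x] by auto
    define x1 where "x1 = x + 1"
    define u where "u z = h z - lam / (x1 - ln (norm z))" for z
    define M1 where "M1 = maxmod h 0 (exp x1)"
    have hM1: "h z \<le> M1" if "norm z \<le> exp x1" for z
      using le_maxmod[OF continuous_h, of z 0] maxmod_mono_radius[OF subharmonic_h, of "norm z" "exp x1" 0] that
      by (simp add: M1_def)
    \<comment> \<open>Beyond x2 the barrier is at least M1 + 4 lam, so u <= -4 lam, whereas u z1 >=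
      -2 lam. Inside radius exp (x + 1/4) the drop by \<open>L\<close> also keeps \<open>u\<close>
      below u z1. Hence a maximum over the compact annulus \<open>A\<close> dominates
      \<open>u\<close> up to radius exp x1.\<close>
    define x2 where "x2 = x1 - lam / (M1 + 4 * lam)"
    have lam: "lam > 0"
      by (simp add: lam_def)
    have uz1: "u z1 = h z1 - 2 * lam"
      using z1(1) by (simp add: u_def x1_def)
    have "M1 \<ge> 0"
      using hM1[of 0] h_nonneg[of 0] by simp
    have M1: "0 < lam / (M1 + 4 * lam)" "lam / (M1 + 4 * lam) \<le> 1 / 4"
      using \<open>M1 \<ge> 0\<close> lam by (auto simp: divide_simps)
    have x2: "x + 3/4 \<le> x2" "x2 < x1"
      using M1 by (auto simp: x2_def x1_def)
    define A :: "complex set" where "A = cball 0 (exp x2) - ball 0 (exp (x + 1/4))"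
    have A_iff: "z \<in> A \<longleftrightarrow> x + 1/4 \<le> ln (norm z) \<and> ln (norm z) \<le> x2" if "z \<noteq> 0" for z
      using that by (auto simp: A_def not_less ln_ge_iff ln_norm_le_iff)
    have A0: "z \<noteq> 0" if "z \<in> A" for z
      using that by (auto simp: A_def)
    have "compact A"
      unfolding A_def by (intro compact_diff) auto
    moreover have "z1 \<in> A"
      using x2 z1(1) by (subst A_iff) auto
    moreover have "continuous_on A u"
      unfolding u_def using A0 A_iff x2 by (intro continuous_intros continuous_on_h) force+
    ultimately obtain z0 where z0: "z0 \<in> A" "\<And>z. z \<in> A \<Longrightarrow> u z \<le> u z0"
      using continuous_attains_sup[of A u] by blast
    have u1: "u z1 \<le> u z0"
      by (rule z0(2)[OF \<open>z1 \<in> A\<close>])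
    have umax: "u z \<le> u z0" if nz: "z \<noteq> 0" and "ln (norm z) < x1" for z
    proof -
      consider "ln (norm z) < x + 1/4" | "z \<in> A" | "ln (norm z) > x2"
        using A_iff[OF nz] by linarith
      then show ?thesis
      proof cases
        case 1
        then have "norm z \<le> exp (x + 1/4)"
          using that(1) by (simp add: ln_norm_le_iff[symmetric])
        then have "h z \<le> h z1 - L"
          by (rule z1(3))
        moreover have "lam / (x1 - ln (norm z)) \<ge> 0"
          using lam that by simp
        ultimately have "u z \<le> u z1"
          unfolding uz1 by (simp add: u_def L_def)
        then show ?thesis
          using u1 by linarith
      next
        case 3
        have "x1 - ln (norm z) \<le> lam / (M1 + 4 * lam)"
          using 3 by (simp add: x2_def)
        then have "(x1 - ln (norm z)) * (M1 + 4 * lam) \<le> lam"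
          using \<open>M1 \<ge> 0\<close> lam by (simp add: pos_le_divide_eq)
        then have "lam / (x1 - ln (norm z)) \<ge> M1 + 4 * lam"
          using that(2) by (simp add: pos_le_divide_eq mult.commute)
        moreover have "norm z \<le> exp x1"
          using that by (simp add: ln_norm_le_iff[symmetric])
        ultimately have "u z \<le> - 4 * lam"
          using hM1[of z] by (simp add: u_def)
        also have "\<dots> \<le> u z1"
          using h_nonneg[of z1] lam by (simp add: uz1)
        finally show ?thesis
          using u1 by linarith
      qed (rule z0(2))
    qed
    define xs where "xs = ln (norm z0)"
    define \<tau> where "\<tau> = x1 - xs"
    define a where "a = lam / \<tau>\<^sup>2"
    define r where "r = norm z0"
    \<comment> \<open>The derivative of log f at \<open>z0\<close> will have modulus at least a / r,
      so radius s/2 = 60 r / a supplies the 60 of \<open>annulus_covering\<close>. In units of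
      \<open>r\<close>, \<open>\<rho>\<close> is the radius 30 s required by
      \<open>no_hole\<close>.\<close>
    define s where "s = 120 * r / a"
    define \<rho> where "\<rho> = 3600 * \<tau>\<^sup>2 / lam"
    have z0nz: "z0 \<noteq> 0"
      using A0 z0 by blast
    then have r: "r > 0" "ln r = xs" "exp xs = r"
      by (auto simp: r_def xs_def)
    have \<tau>: "0 < \<tau>" "\<tau> \<le> 3/4"
      using z0(1) A_iff[OF z0nz] x2 by (auto simp: \<tau>_def xs_def x1_def)
    have a: "a > 0"
      using lam \<tau> by (simp add: a_def)
    have s: "s > 0" "30 * s = \<rho> * r"
      using a r lam \<tau> by (auto simp: s_def \<rho>_def a_def)
    have \<rho>: "0 < \<rho>" "2 * \<rho> \<le> \<tau> / 2" "2 * \<rho> \<le> 1/4" "a * (2 * \<rho>) = 7200"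
    proof -
      have "\<tau> * \<tau> \<le> \<tau> * 1"
        using \<tau> by (intro mult_left_mono) auto
      then have t2: "\<tau>\<^sup>2 \<le> \<tau>"
        by (simp add: power2_eq_square)
      show "0 < \<rho>" "a * (2 * \<rho>) = 7200"
        using \<tau> lam by (auto simp: \<rho>_def a_def)
      show "2 * \<rho> \<le> \<tau> / 2" "2 * \<rho> \<le> 1/4"
        using t2 \<tau> by (auto simp: \<rho>_def lam_def)
    qed
    define d where "d z = ln (norm z) - xs" for z :: complex
    have near: "z \<noteq> 0" "\<bar>d z\<bar> \<le> 2 * \<rho>" "norm (z / z0 - 1) < 1" "Re (Ln (z / z0)) = d z"
      if "z \<in> ball z0 (30 * s)" for z
    proof -
      have "norm (z - z0) < \<rho> * r"
        using that s by (simp add: dist_norm norm_minus_commute)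
      then have q: "norm (z / z0 - 1) < \<rho>"
        using z0nz r by (simp add: r_def divide_simps norm_divide flip: diff_divide_distrib)
      then show q1: "norm (z / z0 - 1) < 1"
        using \<rho> by linarith
      show z: "z \<noteq> 0"
        using q1 by auto
      have "norm (1 + (z / z0 - 1)) = norm z / r"
        by (simp add: norm_divide r_def)
      then have *: "d z = ln (norm (1 + (z / z0 - 1)))"
        using z r by (simp add: d_def ln_div)
      show "\<bar>d z\<bar> \<le> 2 * \<rho>"
        unfolding * using q \<rho> by (intro abs_ln_norm_add_le) auto
      show "Re (Ln (z / z0)) = d z"
        using z z0nz by (simp add: * norm_divide)
    qed
    have h_maj: "h z \<le> h z0 + a * d z + 1/30" if z: "z \<in> ball z0 (30 * s)" for z
    proof -
      have dz: "\<bar>d z\<bar> \<le> \<tau> / 2" "\<bar>d z\<bar> \<le> 2 * \<rho>"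
        using near(2)[OF z] \<rho> by auto
      have "x1 - ln (norm z) = \<tau> - d z" "x1 - ln (norm z0) = \<tau>"
        by (auto simp: \<tau>_def d_def xs_def)
      moreover have "d z < \<tau>"
        using dz \<tau> by linarith
      then have "u z \<le> u z0"
        using near(1)[OF z] by (intro umax) (auto simp: d_def \<tau>_def)
      ultimately have "h z \<le> h z0 + (lam / (\<tau> - d z) - lam / \<tau>)"
        by (simp add: u_def)
      also have "\<dots> \<le> h z0 + (a * d z + 2 * lam * (d z)\<^sup>2 / \<tau> ^ 3)"
        using barrier_taylor[OF lam \<tau>(1) dz(1)] by (simp add: a_def)
      also have "2 * lam * (d z)\<^sup>2 / \<tau> ^ 3 \<le> 2 * lam * (2 * \<rho>)\<^sup>2 / \<tau> ^ 3"
        using power_mono[OF dz(2), of 2] lam \<tau> by (intro divide_right_mono mult_left_mono) auto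
      also have "\<dots> = 2 * 7200\<^sup>2 * \<tau> / lam"
        using lam \<tau> by (simp add: \<rho>_def power2_eq_square power3_eq_cube divide_simps)
      also have "\<dots> \<le> 1/30"
        using \<tau> by (simp add: lam_def)
      finally show ?thesis
        by simp
    qed
    \<comment> \<open>Where h > k one has ln|f| > c + k >= x + 1, so the covered annulus lies at
      least one logarithmic unit further out.\<close>
    define k where "k = max 0 (x + 1 - c)"
    interpret trunc: log_tract "{z. h z > k}" f "\<lambda>z. max (h z - k) 0" "c + k"
      by (rule truncation) (simp add: k_def)
    have hz0: "h z0 - k \<ge> 7202"
    proof -
      have "h z0 \<ge> u z0"
        using lam \<tau> by (simp add: u_def \<tau>_def xs_def)
      then have "h z0 \<ge> x + L - 2 * lam"
        using u1 uz1 z1(2) by linarith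
      then show ?thesis
        using x by (auto simp: k_def L_def)
    qed
    have "ball z0 s \<subseteq> {z. h z > k}"
    \<comment> \<open>The majorant is a ln|z / z0|, the real part of a principal logarithm, since z
      / z0 stays within distance 1 of 1. The bound 7200 is a times 2 \<rho>.\<close>
    proof (rule trunc.no_hole[of s "\<lambda>z. of_real a * Ln (z / z0)" z0 7200, OF s(1)])
      have "z / z0 \<notin> \<real>\<^sub>\<le>\<^sub>0" if "z \<in> ball z0 (30 * s)" for z
        using near(3)[OF that] abs_Re_le_cmod[of "z / z0 - 1"]
        unfolding complex_nonpos_Reals_iff minus_complex.sel one_complex.sel by linarith
      then show "(\<lambda>z. of_real a * Ln (z / z0)) holomorphic_on ball z0 (30 * s)"
        by (intro holomorphic_intros) (use z0nz in auto)
      show "of_real a * Ln (z0 / z0) = 0"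
        using z0nz by simp
      show "7200 + 2 \<le> max (h z0 - k) 0"
        using hz0 by simp
      fix z assume z: "z \<in> ball z0 (30 * s)"
      have eq: "Re (of_real a * Ln (z / z0)) = a * d z"
        using near(4)[OF z] by simp
      have "\<bar>a * d z\<bar> \<le> a * (2 * \<rho>)"
        using near(2)[OF z] a by (simp add: abs_mult)
      then show bd: "\<bar>Re (of_real a * Ln (z / z0))\<bar> \<le> 7200"
        unfolding eq \<rho>(4) .
      \<comment> \<open>Truncation at 0 is harmless: the right side is at least 7202 - 7200 >
        0.\<close>
      show "max (h z - k) 0 \<le> max (h z0 - k) 0 + Re (of_real a * Ln (z / z0)) + 1 / 30"
        using h_maj[OF z] hz0 bd unfolding eq by (auto simp: abs_le_iff)
    qed
    then have inD: "ball z0 s \<subseteq> D" "\<And>z. z \<in> ball z0 s \<Longrightarrow> h z > k"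
      using trunc.h_pos_iff h_pos_iff by (auto simp: k_def)
    then have "f holomorphic_on ball z0 s"
      using holomorphic holomorphic_on_subset by blast
    then obtain g where g: "g holomorphic_on ball z0 s" "\<And>z. z \<in> ball z0 s \<Longrightarrow> f z = exp (g z)"
      using contractible_imp_holomorphic_log[of f "ball z0 s"] convex_imp_contractible[OF convex_ball]
        nonzero inD(1) by (metis subsetD)
    have Re_g: "Re (g z) = h z + c" if "z \<in> ball z0 s" for z
      using h_eq[of z] inD(1) g(2)[OF that] that by auto
    \<comment> \<open>Along the ray through \<open>z0\<close>, parametrized as z0 exp t,
      \<open>u\<close> has a local maximum at t = 0, so the derivatives of Re g and of the barrier
      agree there: Re (z0 g'(z0)) = a.\<close>
    have deriv_g: "r * norm (deriv g z0) \<ge> a"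
    proof -
      define \<phi> where "\<phi> t = Re (g (z0 * of_real (exp t))) - lam / (\<tau> - t)" for t
      have g': "(g has_field_derivative deriv g z0) (at z0)"
        using holomorphic_derivI[OF g(1) open_ball] s(1) by simp
      have "((\<lambda>t. z0 * of_real (exp t)) has_vector_derivative z0) (at (0::real))"
        by (auto intro!: derivative_eq_intros)
      then have "((g \<circ> (\<lambda>t. z0 * of_real (exp t))) has_vector_derivative (z0 * deriv g z0)) (at (0::real))"
        using g' by (intro field_vector_diff_chain_at) auto
      then have "((\<lambda>t. Re (g (z0 * of_real (exp t)))) has_vector_derivative Re (z0 * deriv g z0)) (at (0::real))"
        unfolding o_def by (rule bounded_linear.has_vector_derivative[OF bounded_linear_Re])
      then have "((\<lambda>t. Re (g (z0 * of_real (exp t)))) has_real_derivative Re (z0 * deriv g z0)) (at (0::real))"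
        by (simp add: has_real_derivative_iff_has_vector_derivative)
      moreover have "((\<lambda>t. lam / (\<tau> - t)) has_real_derivative a) (at 0)"
        using \<tau> by (auto intro!: derivative_eq_intros simp: a_def power2_eq_square)
      ultimately have D\<phi>: "(\<phi> has_real_derivative Re (z0 * deriv g z0) - a) (at 0)"
        unfolding \<phi>_def by (rule DERIV_diff)
      have "isCont (\<lambda>t. z0 * of_real (exp t)) (0::real)"
        by (intro continuous_intros)
      then obtain e where e: "e > 0" "\<And>t::real. \<bar>t\<bar> < e \<Longrightarrow> dist (z0 * of_real (exp t)) z0 < s"
        unfolding continuous_at_eps_delta using s(1) by (force simp: dist_real_def)
      have "Re (z0 * deriv g z0) - a = 0"
      proof (rule DERIV_local_max[OF D\<phi>, of "min e \<tau>"])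
        show "\<forall>t. \<bar>0 - t\<bar> < min e \<tau> \<longrightarrow> \<phi> t \<le> \<phi> 0"
        proof (intro allI impI)
          fix t :: real assume t: "\<bar>0 - t\<bar> < min e \<tau>"
          have b: "z0 * of_real (exp t) \<in> ball z0 s" "z0 \<in> ball z0 s"
            using e(2)[of t] t s(1) by (auto simp: dist_commute)
          have n: "ln (norm (z0 * of_real (exp t))) = xs + t"
            using z0nz by (simp add: norm_mult ln_mult xs_def)
          have "u (z0 * of_real (exp t)) \<le> u z0"
            using z0nz n t by (intro umax) (auto simp: \<tau>_def)
          then show "\<phi> t \<le> \<phi> 0"
            using Re_g[OF b(1)] Re_g[OF b(2)] n unfolding u_def \<phi>_def
            by (simp add: \<tau>_def xs_def algebra_simps)
        qed
      qed (use e \<tau> in auto)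
      then have "a \<le> norm (z0 * deriv g z0)"
        using complex_Re_le_cmod[of "z0 * deriv g z0"] by simp
      then show ?thesis
        by (simp add: norm_mult r_def)
    qed
    obtain y where y: "y \<ge> c + k"
      "\<And>w::complex. exp y \<le> norm w \<Longrightarrow> norm w \<le> exp (y + 1) \<Longrightarrow> \<exists>\<zeta>\<in>ball z0 (s / 2). exp (g \<zeta>) = w"
    proof (rule annulus_covering[of g z0 "s / 2" "c + k"])
      show "g holomorphic_on ball z0 (s / 2)"
        using g(1) by (rule holomorphic_on_subset) (use s in auto)
      have "60 = 60 / a * a"
        using a by simp
      also have "\<dots> \<le> 60 / a * (r * norm (deriv g z0))"
        using deriv_g a by (intro mult_left_mono) auto
      also have "\<dots> = s / 2 * norm (deriv g z0)"
        by (simp add: s_def)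
      finally show "60 \<le> s / 2 * norm (deriv g z0)" .
      show "c + k < Re (g \<zeta>)" if "\<zeta> \<in> ball z0 (s / 2)" for \<zeta>
        using that s(1) Re_g[of \<zeta>] inD(2)[of \<zeta>] by auto
    qed (use s in simp, rule that)
    let ?K = "cball z0 (s / 2)"
    have "?K \<subseteq> ball z0 s"
      using s(1) by auto
    then have "?K \<subseteq> D"
      using inD by blast
    moreover have "?K \<subseteq> {z. exp x \<le> norm z \<and> norm z \<le> exp (x + 1)}"
    proof
      fix z assume "z \<in> ?K"
      then have z: "z \<in> ball z0 (30 * s)"
        using s(1) by auto
      have "x + 1/4 \<le> xs"
        using z0(1) A_iff[OF z0nz] by (simp add: xs_def)
      then have "x \<le> ln (norm z)" "ln (norm z) \<le> x + 1"
        using near(2)[OF z] \<rho> \<tau> by (auto simp: d_def \<tau>_def x1_def abs_le_iff)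
      then show "z \<in> {z. exp x \<le> norm z \<and> norm z \<le> exp (x + 1)}"
        using near(1)[OF z] by (simp add: ln_ge_iff ln_norm_le_iff)
    qed
    moreover have "y \<ge> x + 1"
      using y(1) by (simp add: k_def)
    moreover have "{w. exp y \<le> norm w \<and> norm w \<le> exp (y + 1)} \<subseteq> f ` ?K"
    proof
      fix w :: complex assume "w \<in> {w. exp y \<le> norm w \<and> norm w \<le> exp (y + 1)}"
      then obtain \<zeta> where "\<zeta> \<in> ball z0 (s / 2)" "exp (g \<zeta>) = w"
        using y(2) by blast
      then show "w \<in> f ` ?K"
        using g(2)[of \<zeta>] s(1) by (intro image_eqI[of _ _ \<zeta>]) auto
    qed
    ultimately show "\<exists>K y. compact K \<and> K \<subseteq> D \<and> K \<subseteq> {z. exp x \<le> norm z \<and> norm z \<le> exp (x + 1)} \<and>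
        y \<ge> x + 1 \<and> {w. exp y \<le> norm w \<and> norm w \<le> exp (y + 1)} \<subseteq> f ` K"
      by (intro exI[of _ ?K] exI[of _ y]) auto
  qed
qed

end

section \<open>Orbits along a chain of compact sets\<close>

lemma orbit_through_compacts:
  fixes K :: "nat \<Rightarrow> complex set"
  assumes K: "\<And>n. compact (K n)" "\<And>n. K n \<noteq> {}" and f: "\<And>n. continuous_on (K n) f"
    and cover: "\<And>n. K (Suc n) \<subseteq> f ` K n"
  obtains z where "\<And>n. (f ^^ n) z \<in> K n"
proof -
  \<comment> \<open>The points that start in \<open>K m\<close> and follow the chain for
    \<open>n\<close> steps. The start index varies because continuity of \<open>f\<close> is given
    only on each \<open>K m\<close>: closedness comes from pulling back one application of
    \<open>f\<close> at a time.\<close>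
  define E where "E n m = {z. \<forall>j\<le>n. (f ^^ j) z \<in> K (m + j)}" for n m
  have E_Suc: "E (Suc n) m = K m \<inter> f -` E n (Suc m)" for n m
  proof (intro equalityI subsetI)
    fix z assume "z \<in> E (Suc n) m"
    then have *: "\<forall>j\<le>Suc n. (f ^^ j) z \<in> K (m + j)"
      by (simp add: E_def)
    have "(f ^^ j) (f z) \<in> K (Suc m + j)" if "j \<le> n" for j
      using *[rule_format, of "Suc j"] that by (simp add: funpow_swap1)
    moreover have "z \<in> K m"
      using *[rule_format, of 0] by simp
    ultimately show "z \<in> K m \<inter> f -` E n (Suc m)"
      by (simp add: E_def)
  next
    fix z assume z: "z \<in> K m \<inter> f -` E n (Suc m)"
    have "(f ^^ j) z \<in> K (m + j)" if "j \<le> Suc n" for j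
    proof (cases j)
      case (Suc i)
      then show ?thesis
        using z that by (auto simp: E_def funpow_swap1)
    qed (use z in auto)
    then show "z \<in> E (Suc n) m"
      by (simp add: E_def)
  qed
  have cpt: "compact (E n m)" for n m
  proof (induction n arbitrary: m)
    case 0
    then show ?case using K by (simp add: E_def)
  next
    case (Suc n)
    have "closed (K m \<inter> f -` E n (Suc m))"
      using Suc by (intro continuous_closed_preimage f compact_imp_closed K)
    then show ?case
      unfolding E_Suc using K(1)[of m] by (meson Int_lower1 bounded_subset compact_eq_bounded_closed)
  qed
  have ex: "\<exists>z\<in>E n m. (f ^^ n) z = y" if "y \<in> K (m + n)" for n m y
    using that
  proof (induction n arbitrary: m)
    case (Suc n)
    then have "\<exists>z\<in>E n (Suc m). (f ^^ n) z = y"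
      by (intro Suc.IH) simp
    then obtain z where z: "z \<in> E n (Suc m)" "(f ^^ n) z = y"
      by blast
    then have "z \<in> K (Suc m)"
      by (auto simp: E_def dest: spec[of _ 0])
    then obtain x where "x \<in> K m" "f x = z"
      using cover by blast
    then show ?case
      using z unfolding E_Suc by (intro bexI[of _ x]) (auto simp: funpow_swap1)
  qed (auto simp: E_def)
  have "(\<Inter>n. E n 0) \<noteq> {}"
  proof (rule compact_nest)
    show "E n 0 \<noteq> {}" for n
      using ex[of _ 0 n] K(2)[of n] by fastforce
    show "E n 0 \<subseteq> E m 0" if "m \<le> n" for m n
      using that by (auto simp: E_def)
  qed (rule cpt)
  then obtain z where z: "\<And>n. z \<in> E n 0"
    by blast
  then have "(f ^^ n) z \<in> K n" for n
    using z[of n] by (auto simp: E_def)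
  then show ?thesis
    by (rule that)
qed

lemma (in log_tract) escaping_orbit:
  assumes "D \<noteq> {}" and "\<not> bounded (- D)"
  shows "\<exists>z0\<in>D. (\<forall>n. (f ^^ n) z0 \<in> D) \<and> filterlim (\<lambda>n. (f ^^ n) z0) at_infinity sequentially"
proof -
  define A where "A x = {z::complex. exp x \<le> norm z \<and> norm z \<le> exp (x + 1)}" for x
  obtain X where "\<And>x. x \<ge> X \<Longrightarrow> \<exists>K y. compact K \<and> K \<subseteq> D \<and> K \<subseteq> A x \<and> y \<ge> x + 1 \<and> A y \<subseteq> f ` K"
    using covering_step[OF assms] unfolding A_def by blast
  then obtain C n where step: "\<And>x. x \<ge> X \<Longrightarrow> compact (C x) \<and> C x \<subseteq> D \<and> C x \<subseteq> A x \<and> n x \<ge> x + 1 \<and> A (n x) \<subseteq> f ` C x"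
    by metis
  define xs where "xs k = (n ^^ k) X" for k
  have xs: "xs k \<ge> X + k" for k
  proof (induction k)
    case (Suc k)
    then show ?case
      using step[of "xs k"] by (simp add: xs_def)
  qed (simp add: xs_def)
  have X: "X \<le> xs k" for k
    using xs[of k] by simp
  have ne: "C x \<noteq> {}" if "x \<ge> X" for x
  proof -
    have "of_real (exp (n x)) \<in> A (n x)"
      by (simp add: A_def)
    then show ?thesis
      using step[OF that] by blast
  qed
  obtain z where z: "\<And>k. (f ^^ k) z \<in> C (xs k)"
  proof (rule orbit_through_compacts[of "\<lambda>k. C (xs k)" f])
    fix k
    show "compact (C (xs k))" "C (xs k) \<noteq> {}"
      using step[OF X] ne[OF X] by auto
    show "continuous_on (C (xs k)) f"
      using step[OF X] holomorphic_on_imp_continuous_on[OF holomorphic] continuous_on_subset by blast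
    have "C (xs (Suc k)) \<subseteq> A (n (xs k))"
      using step[OF X, of "Suc k"] by (simp add: xs_def)
    then show "C (xs (Suc k)) \<subseteq> f ` C (xs k)"
      using step[OF X, of k] by blast
  qed (rule that)
  have inD: "(f ^^ k) z \<in> D" for k
    using z[of k] step[OF X] by blast
  have "filterlim (\<lambda>k. norm ((f ^^ k) z)) at_top sequentially"
  proof (rule filterlim_at_top_mono)
    show "filterlim (\<lambda>k. X + real k) at_top sequentially"
      by (intro filterlim_tendsto_add_at_top[OF tendsto_const] filterlim_real_sequentially)
    have "X + real k \<le> norm ((f ^^ k) z)" for k
    proof -
      have "X + real k \<le> exp (xs k)"
        using xs[of k] exp_ge_add_one_self[of "xs k"] by linarith
      also have "\<dots> \<le> norm ((f ^^ k) z)"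
        using z[of k] step[OF X, of k] by (auto simp: A_def)
      finally show ?thesis .
    qed
    then show "\<forall>\<^sub>F k in sequentially. X + real k \<le> norm ((f ^^ k) z)"
      by simp
  qed
  then have "filterlim (\<lambda>k. (f ^^ k) z) at_infinity sequentially"
    by (rule filterlim_norm_at_top_imp_at_infinity)
  then show ?thesis
    using inD inD[of 0] by auto
qed

text \<open>On the closure of \<open>D\<close> the function ln|f| - ln R is continuous and vanishes
  on the frontier, so it glues with 0 on the closed complement; values of \<open>f\<close> off the
  closure never enter.\<close>

lemma log_tract_direct_tract:
  assumes "open D" "f holomorphic_on D" "continuous_on (closure D) f" "R > 0"
    and fr: "\<And>z. z \<in> frontier D \<Longrightarrow> norm (f z) = R" and D: "\<And>z. z \<in> D \<Longrightarrow> norm (f z) > R"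
  shows "log_tract D f (\<lambda>z. if z \<in> D then ln (norm (f z)) - ln R else 0) (ln R)"
proof
  have cl: "norm (f z) \<ge> R" if "z \<in> closure D" for z
    using that fr D \<open>open D\<close> by (force simp: frontier_def interior_open)
  have "continuous_on (closure D \<union> - D) (\<lambda>z. if z \<in> closure D then ln (norm (f z)) - ln R else 0)"
  proof (rule continuous_on_If)
    show "closed (- D)"
      using \<open>open D\<close> by auto
    have "norm (f z) \<noteq> 0" if "z \<in> closure D" for z
      using cl[OF that] \<open>R > 0\<close> by linarith
    then show "continuous_on (closure D) (\<lambda>z. ln (norm (f z)) - ln R)"
      by (intro continuous_intros assms(3)) auto
    show "ln (norm (f z)) - ln R = 0" if "z \<in> - D" "z \<in> closure D" for z
      using that fr \<open>open D\<close> by (simp add: frontier_def interior_open)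
  qed auto
  moreover have "closure D \<union> - D = UNIV"
    using closure_subset by blast
  moreover have "(\<lambda>z. if z \<in> closure D then ln (norm (f z)) - ln R else 0) = (\<lambda>z. if z \<in> D then ln (norm (f z)) - ln R else 0)"
    using closure_subset fr \<open>open D\<close> by (auto simp: fun_eq_iff frontier_def interior_open)
  ultimately show "continuous_on UNIV (\<lambda>z. if z \<in> D then ln (norm (f z)) - ln R else 0)"
    by (simp only:)
next
  fix z assume "z \<in> D"
  then have "R < norm (f z)"
    by (rule D)
  then show "f z \<noteq> 0" "(if z \<in> D then ln (norm (f z)) - ln R else 0) > 0"
    using \<open>z \<in> D\<close> \<open>R > 0\<close> by (auto intro!: ln_less_cancel_iff[THEN iffD2])
qed (use assms in auto)

theorem theorem3p1:
  fixes D :: "complex set" and f :: "complex \<Rightarrow> complex"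
  assumes "direct_tract D f"
  shows "\<exists>z0\<in>D. (\<forall>n. (f ^^ n) z0 \<in> D) \<and> filterlim (\<lambda>n. (f ^^ n) z0) at_infinity sequentially"
proof -
  obtain R where R: "R > 0" "\<And>z. z \<in> frontier D \<Longrightarrow> norm (f z) = R" "\<And>z. z \<in> D \<Longrightarrow> norm (f z) > R"
    using assms unfolding direct_tract_def by blast
  have "log_tract D f (\<lambda>z. if z \<in> D then ln (norm (f z)) - ln R else 0) (ln R)"
    using assms R by (intro log_tract_direct_tract) (auto simp: direct_tract_def)
  then show ?thesis
    by (rule log_tract.escaping_orbit) (use assms in \<open>auto simp: direct_tract_def\<close>)
qed

end
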